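(* Let $d\in\mathbb{N}$ and let $\mathscr C$ be a graph class of bounded expansion. Then there exists $c\in\mathbb{N}$ such that for every graph $G\in\mathscr C$ there exists a proper coloring of $G$ with $c$ colors satisfying the following condition: for every vertex $u$ of $G$ and every color $i$, the number of vertices of color $i$ that are at distance at most $d$ from $u$ in $G$ is either zero or odd.
   Context: All graphs are finite, simple and undirected. A proper coloring of $G$ is a map from $V(G)$ to a finite set of colors assigning different colors to adjacent vertices. For $d\in\mathbb{N}$, a graph $H$ is a depth-$d$ minor of $G$ if one can assign to each $u\in V(H)$ a connected subgraph $\eta(u)$ of $G$ of radius at most $d$, the subgraphs $\eta(u)$ pairwise vertex-disjoint, such that for each edge $uv$ of $H$ there is an edge of $G$ between $\eta(u)$ and $\eta(v)$. $\nabla_d(G)$ is the maximum average degree of a depth-$d$ minor of $G$. A graph class $\mathscr C$ has bounded expansion if for every $d\in\mathbb{N}$ there is a constant bounding $\nabla_d(G)$ for all $G\in\mathscr C$. *)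

theory Defs
  imports "Graph_Theory.Graph_Theory"
begin

text \<open>
  Finite simple undirected graphs are represented by \<^locale>\<open>pair_graph\<close>: an edge \<open>uv\<close> is
  the pair of arcs \<open>(u, v)\<close> and \<open>(v, u)\<close>.
\<close>

definition gdist :: "'a pair_pre_digraph \<Rightarrow> 'a \<Rightarrow> 'a \<Rightarrow> ereal" where
  "gdist G u v = wf_digraph.\<mu> (with_proj G) (\<lambda>_. 1) u v"

definition gradius :: "'a pair_pre_digraph \<Rightarrow> ereal" where
  "gradius G = (INF c\<in>pverts G. SUP v\<in>pverts G. gdist G c v)"

definition depth_minor_model ::
  "nat \<Rightarrow> 'b pair_pre_digraph \<Rightarrow> 'a pair_pre_digraph \<Rightarrow> ('b \<Rightarrow> 'a pair_pre_digraph) \<Rightarrow> bool" where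
  "depth_minor_model d H G \<eta> \<longleftrightarrow>
     (\<forall>u\<in>pverts H. pair_graph (\<eta> u) \<and> subgraph (with_proj (\<eta> u)) (with_proj G) \<and>
        connected (with_proj (\<eta> u)) \<and> gradius (\<eta> u) \<le> ereal (real d)) \<and>
     (\<forall>u\<in>pverts H. \<forall>v\<in>pverts H. u \<noteq> v \<longrightarrow> pverts (\<eta> u) \<inter> pverts (\<eta> v) = {}) \<and>
     (\<forall>(u, v)\<in>parcs H. \<exists>x\<in>pverts (\<eta> u). \<exists>y\<in>pverts (\<eta> v). (x, y) \<in> parcs G)"

definition depth_minor :: "nat \<Rightarrow> 'b pair_pre_digraph \<Rightarrow> 'a pair_pre_digraph \<Rightarrow> bool" where
  "depth_minor d H G \<longleftrightarrow> pair_graph H \<and> (\<exists>\<eta>. depth_minor_model d H G \<eta>)"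

definition avg_degree :: "'a pair_pre_digraph \<Rightarrow> real" where
  "avg_degree G =
     (\<Sum>v\<in>pverts G. real (out_degree (with_proj G) v)) / real (card (pverts G))"

text \<open>
  The minors in \<open>nabla\<close> have vertices in \<^typ>\<open>nat\<close>, which contains a copy of every finite graph;
  see \<open>avg_degree_le_nabla\<close> below for minors with vertices in any other type. The empty
  graph has average degree \<open>0 / 0 = 0\<close>, so it has no influence on the maximum.
\<close>

definition nabla :: "nat \<Rightarrow> 'a pair_pre_digraph \<Rightarrow> real" where
  "nabla d G = Max {avg_degree H | H :: nat pair_pre_digraph. depth_minor d H G}"

definition bounded_expansion :: "'a pair_pre_digraph set \<Rightarrow> bool" where
  "bounded_expansion \<C> \<longleftrightarrow> (\<forall>d. \<exists>k. \<forall>G\<in>\<C>. nabla d G \<le> k)"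

definition proper_coloring :: "'a pair_pre_digraph \<Rightarrow> 'c set \<Rightarrow> ('a \<Rightarrow> 'c) \<Rightarrow> bool" where
  "proper_coloring G K f \<longleftrightarrow>
     finite K \<and> f ` pverts G \<subseteq> K \<and> (\<forall>(u, v)\<in>parcs G. f u \<noteq> f v)"


lemma gdist_le_iff:
  assumes "pair_wf_digraph G"
  shows "gdist G u v \<le> ereal (real d) \<longleftrightarrow>
           (\<exists>p. pre_digraph.awalk (with_proj G) u p v \<and> length p \<le> d)"
proof -
  interpret W: wf_digraph "with_proj G" using assms by (simp add: wf_digraph_wp_iff)
  have cost: "W.awalk_cost (\<lambda>_. 1) p = real (length p)" for p :: "('a \<times> 'a) awalk"
    by (simp add: W.awalk_cost_def sum_list_triv)
  have eq: "gdist G u v = (INF p\<in>{p. W.awalk u p v}. ereal (real (length p)))"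
    unfolding gdist_def W.\<mu>_def cost ..
  show ?thesis
  proof
    assume le: "gdist G u v \<le> ereal (real d)"
    have "ereal (real d) < ereal (real (Suc d))" by simp
    with le have "(INF p\<in>{p. W.awalk u p v}. ereal (real (length p))) < ereal (real (Suc d))"
      unfolding eq by (rule le_less_trans)
    then show "\<exists>p. W.awalk u p v \<and> length p \<le> d"
      unfolding INF_less_iff by (auto simp: less_Suc_eq_le)
  next
    assume "\<exists>p. W.awalk u p v \<and> length p \<le> d"
    then show "gdist G u v \<le> ereal (real d)"
      unfolding eq by (auto intro!: INF_lower2)
  qed
qed

lemma gradius_le_iff:
  assumes "finite (pverts G)" "pverts G \<noteq> {}"
  shows "gradius G \<le> r \<longleftrightarrow> (\<exists>c\<in>pverts G. \<forall>v\<in>pverts G. gdist G c v \<le> r)"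
proof -
  let ?e = "\<lambda>c. SUP v\<in>pverts G. gdist G c v"
  have "gradius G = Min (?e ` pverts G)"
    unfolding gradius_def using assms by (intro cInf_eq_Min) auto
  then have "gradius G \<le> r \<longleftrightarrow> (\<exists>c\<in>pverts G. ?e c \<le> r)"
    using assms by (simp add: Min_le_iff)
  then show ?thesis by (simp add: SUP_le_iff)
qed

lemma avg_degree_eq:
  assumes "pair_fin_digraph G"
  shows "avg_degree G = real (card (parcs G)) / real (card (pverts G))"
proof -
  interpret pair_fin_digraph G by fact
  have "card (parcs G) = card (\<Union>v\<in>pverts G. out_arcs (with_proj G) v)"
    by (rule arg_cong[where f = card]) (auto simp: out_arcs_def intro: in_arcsD1)
  also have "\<dots> = (\<Sum>v\<in>pverts G. out_degree (with_proj G) v)"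
    unfolding out_degree_def using pair_finite_verts pair_finite_arcs
    by (intro card_UN_disjoint) (auto simp: out_arcs_def)
  finally show ?thesis by (simp add: avg_degree_def)
qed

lemma depth_minor_card_le:
  assumes "pair_graph G" "depth_minor d H G"
  shows "card (pverts H) \<le> card (pverts G)"
proof -
  interpret G: pair_graph G by fact
  from assms(2) obtain \<eta> where m: "depth_minor_model d H G \<eta>" and "pair_graph H"
    unfolding depth_minor_def by blast
  have ne: "pverts (\<eta> u) \<noteq> {}" and sub: "pverts (\<eta> u) \<subseteq> pverts G" if "u \<in> pverts H" for u
    using m that unfolding depth_minor_model_def connected_def strongly_connected_def subgraph_def
    by auto
  define r where "r u = (SOME x. x \<in> pverts (\<eta> u))" for u
  have r: "r u \<in> pverts (\<eta> u)" if "u \<in> pverts H" for u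
    unfolding r_def using ne[OF that] by (auto intro: someI)
  have "inj_on r (pverts H)"
  proof (rule inj_onI)
    fix u v assume uv: "u \<in> pverts H" "v \<in> pverts H" "r u = r v"
    then have "pverts (\<eta> u) \<inter> pverts (\<eta> v) \<noteq> {}" using r by (metis IntI empty_iff)
    with uv m show "u = v" unfolding depth_minor_model_def by blast
  qed
  moreover have "r ` pverts H \<subseteq> pverts G" using r sub by blast
  ultimately show ?thesis using G.pair_finite_verts by (rule card_inj_on_le)
qed

lemma nabla_set_finite:
  assumes "pair_graph G"
  shows "finite {avg_degree H | H. depth_minor d H G}"
proof -
  let ?n = "card (pverts G)"
  have "{avg_degree H | H. depth_minor d H G}
      \<subseteq> (\<lambda>(a, b). real a / real b) ` ({..?n * ?n} \<times> {..?n})"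
  proof clarify
    fix H assume H: "depth_minor d H G"
    then interpret H: pair_graph H unfolding depth_minor_def by blast
    have n: "card (pverts H) \<le> ?n" by (rule depth_minor_card_le[OF assms H])
    have "parcs H \<subseteq> pverts H \<times> pverts H" by (auto intro: H.in_arcsD1 H.in_arcsD2)
    then have "card (parcs H) \<le> card (pverts H \<times> pverts H)"
      using H.pair_finite_verts by (intro card_mono) auto
    also have "\<dots> \<le> ?n * ?n" using n by (simp add: card_cartesian_product mult_le_mono)
    finally show "avg_degree H \<in> (\<lambda>(a, b). real a / real b) ` ({..?n * ?n} \<times> {..?n})"
      using n by (auto simp: avg_degree_eq[OF H.pair_fin_digraph] image_iff
          intro!: bexI[of _ "(card (parcs H), card (pverts H))"])
  qed
  then show ?thesis by (rule finite_subset) auto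
qed

lemma depth_minor_copy:
  fixes H :: "'b pair_pre_digraph"
  assumes "depth_minor d H G"
  obtains H' :: "nat pair_pre_digraph" where "depth_minor d H' G" "avg_degree H' = avg_degree H"
proof -
  from assms obtain \<eta> where m: "depth_minor_model d H G \<eta>" and "pair_graph H"
    unfolding depth_minor_def by blast
  interpret H: pair_graph H by fact
  obtain f :: "'b \<Rightarrow> nat" where f: "inj_on f (pverts H)"
    using finite_imp_inj_to_nat_seg[OF H.pair_finite_verts] by metis
  define g where "g = inv_into (pverts H) f"
  have g: "g (f u) = u" if "u \<in> pverts H" for u
    unfolding g_def using f that by (rule inv_into_f_f)
  define H' where "H' = \<lparr>pverts = f ` pverts H, parcs = map_prod f f ` parcs H\<rparr>"
  have arcs: "parcs H \<subseteq> pverts H \<times> pverts H" by (auto intro: H.in_arcsD1 H.in_arcsD2)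
  have "pair_graph H'"
  proof
    fix e assume "e \<in> parcs H'"
    then obtain u v where uv: "e = (f u, f v)" "(u, v) \<in> parcs H" by (auto simp: H'_def)
    then show "fst e \<in> pverts H'" "snd e \<in> pverts H'" using arcs by (auto simp: H'_def)
    from uv arcs H.no_loops'[OF uv(2)] show "fst e \<noteq> snd e"
      using f by (auto dest: inj_onD)
  next
    show "finite (pverts H')" "finite (parcs H')"
      using H.pair_finite_verts H.pair_finite_arcs by (auto simp: H'_def)
    show "symmetric (with_proj H')"
      unfolding symmetric_def H'_def by (auto intro!: symI dest: H.arcs_symmetric)
  qed
  then interpret H': pair_graph H' .
  have "depth_minor_model d H' G (\<eta> \<circ> g)"
    unfolding depth_minor_model_def
  proof (intro conjI ballI impI)
    fix x assume "x \<in> pverts H'"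
    then obtain u where "u \<in> pverts H" "x = f u" by (auto simp: H'_def)
    with m show "pair_graph ((\<eta> \<circ> g) x)" "subgraph (with_proj ((\<eta> \<circ> g) x)) (with_proj G)"
      "connected (with_proj ((\<eta> \<circ> g) x))" "gradius ((\<eta> \<circ> g) x) \<le> ereal (real d)"
      unfolding depth_minor_model_def by (simp_all add: g)
  next
    fix x y assume "x \<in> pverts H'" "y \<in> pverts H'" and xy: "x \<noteq> y"
    then obtain u v where uv: "u \<in> pverts H" "x = f u" "v \<in> pverts H" "y = f v"
      by (auto simp: H'_def)
    with xy have "u \<noteq> v" by blast
    with m uv show "pverts ((\<eta> \<circ> g) x) \<inter> pverts ((\<eta> \<circ> g) y) = {}"
      unfolding depth_minor_model_def by (simp add: g)
  next
    fix e assume "e \<in> parcs H'"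
    then obtain u v where uv: "e = (f u, f v)" "(u, v) \<in> parcs H" by (auto simp: H'_def)
    then have "u \<in> pverts H" "v \<in> pverts H" using arcs by auto
    moreover have "\<exists>x\<in>pverts (\<eta> u). \<exists>y\<in>pverts (\<eta> v). (x, y) \<in> parcs G"
      using m uv(2) unfolding depth_minor_model_def by blast
    ultimately show "case e of (u, v) \<Rightarrow>
        \<exists>x\<in>pverts ((\<eta> \<circ> g) u). \<exists>y\<in>pverts ((\<eta> \<circ> g) v). (x, y) \<in> parcs G"
      by (simp add: uv(1) g)
  qed
  with \<open>pair_graph H'\<close> have "depth_minor d H' G" unfolding depth_minor_def by blast
  moreover have "inj_on (map_prod f f) (parcs H)"
    using map_prod_inj_on[OF f f] arcs by (rule inj_on_subset)
  then have "avg_degree H' = avg_degree H"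
    using f by (simp add: avg_degree_eq[OF H.pair_fin_digraph] avg_degree_eq[OF H'.pair_fin_digraph])
      (simp add: H'_def card_image)
  ultimately show thesis by (rule that)
qed

lemma avg_degree_le_nabla:
  fixes H :: "'b pair_pre_digraph"
  assumes "pair_graph G" "depth_minor d H G"
  shows "avg_degree H \<le> nabla d G"
proof -
  obtain H' :: "nat pair_pre_digraph" where
    H': "depth_minor d H' G" "avg_degree H' = avg_degree H"
    using depth_minor_copy[OF assms(2)] by metis
  then show ?thesis unfolding nabla_def
    by (intro Max_ge nabla_set_finite assms) (auto intro: exI[of _ H'])
qed

lemma nabla_attained:
  assumes "pair_graph G"
  obtains H :: "nat pair_pre_digraph" where "depth_minor d H G" "avg_degree H = nabla d G"
proof -
  let ?S = "{avg_degree H | H :: nat pair_pre_digraph. depth_minor d H G}"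
  let ?E = "\<lparr>pverts = {}, parcs = {}\<rparr> :: nat pair_pre_digraph"
  have "pair_graph ?E" by unfold_locales (auto simp: symmetric_def sym_def)
  then have "depth_minor d ?E G" unfolding depth_minor_def depth_minor_model_def by auto
  then have "?S \<noteq> {}" by blast
  then have "nabla d G \<in> ?S"
    unfolding nabla_def using nabla_set_finite[OF assms] by (intro Max_in)
  then show thesis using that by auto
qed

end

theory Submission
  imports Defs
begin

text \<open>
  Bounded expansion yields a linear order in which every vertex weakly reaches boundedly many
  vertices at distance \<open>4d + 1\<close>, hence a colouring \<open>\<chi>\<close> with boundedly many colours that gives
  distinct colours to any vertex and the vertices it weakly reaches. Classify the vertices \<open>v\<close>
  by a signature: the \<open>\<chi>\<close>-colours of the vertices weakly \<open>d\<close>-reachable from \<open>v\<close>, their order, and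
  their weak distances from \<open>v\<close>. Within one signature class the cones
  \<open>{v. w is weakly d-reachable from v}\<close> form a laminar family of bounded depth, and every ball of
  radius \<open>d\<close> meets the class in a single cone or not at all. A laminar family of depth \<open>m\<close> has the
  required parity colouring with \<open>2^m\<close> colours, by doubling the colours at each level.
\<close>

section \<open>Walks and shallow minors\<close>

text \<open>Parities do not add up over overlapping pieces, and a ball is a union of overlapping
  pieces, one for each vertex \<open>w\<close> that is lowest on a short walk from the centre. The
  signature is built to make this union collapse. Its distance entries make the route through
  \<open>w\<close> short for all of a cone or for none of it; its order entries make the cones
  nested, so that the one with the lowest apex contains the others. Colours stand in for the
  vertices themselves, which keeps the number of signatures bounded. Distinct classes get disjoint
  palettes, so a colour is counted in one class only.

  The radius \<open>4 * d + 1\<close>: two vertices weakly \<open>d\<close>-reached from a common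
  one are \<open>2 * d\<close> apart in weak reachability, and comparing cones chains or compares
  two such stretches, so colours must separate at \<open>4 * d\<close>. The extra step matters for
  \<open>d = 0\<close>, where the ends of an edge must still differ. An order for radius
  \<open>r\<close> draws on minors of depth \<open>2 * r\<close>, because two intersecting balls of
  radius \<open>r\<close> give a connection of about that length.\<close>

primrec reach_within :: "('a \<times> 'a) set \<Rightarrow> 'a set \<Rightarrow> nat \<Rightarrow> 'a \<Rightarrow> 'a \<Rightarrow> bool" where
  "reach_within E X 0 x y \<longleftrightarrow> x \<in> X \<and> y = x"
| "reach_within E X (Suc n) x y \<longleftrightarrow>
     reach_within E X n x y \<or> (\<exists>z. reach_within E X n x z \<and> (z, y) \<in> E \<and> y \<in> X)"

lemma reach_within_refl: "x \<in> X \<Longrightarrow> reach_within E X n x x"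
  by (induction n) auto

lemma reach_within_in: "reach_within E X n x y \<Longrightarrow> x \<in> X \<and> y \<in> X"
  by (induction n arbitrary: y) auto

lemma reach_within_mono:
  "reach_within E X m x y \<Longrightarrow> m \<le> n \<Longrightarrow> X \<subseteq> Y \<Longrightarrow> reach_within E Y n x y"
proof (induction n arbitrary: m y)
  case (Suc n)
  show ?case
  proof (cases "m \<le> n")
    case True
    then show ?thesis using Suc by auto
  next
    case False
    then have "m = Suc n" using Suc.prems by simp
    then show ?thesis using Suc.IH[of n] Suc.prems by auto
  qed
qed auto

lemma reach_within_step:
  "reach_within E X n x z \<Longrightarrow> (z, y) \<in> E \<Longrightarrow> y \<in> X \<Longrightarrow> reach_within E X (Suc n) x y"
  by auto

lemma reach_within_trans:
  "reach_within E X m x y \<Longrightarrow> reach_within E X n y z \<Longrightarrow> reach_within E X (m + n) x z"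
  by (induction n arbitrary: z) auto

lemma reach_within_sym:
  assumes "sym E"
  shows "reach_within E X n x y \<Longrightarrow> reach_within E X n y x"
proof (induction n arbitrary: y)
  case (Suc n)
  show ?case
  proof (cases "reach_within E X n x y")
    case True
    then show ?thesis using Suc.IH by simp
  next
    case False
    then obtain z where z: "reach_within E X n x z" "(z, y) \<in> E" "y \<in> X" using Suc.prems by auto
    then have "reach_within E X 1 y z"
      using assms by (auto dest: symD reach_within_in)
    then show ?thesis using reach_within_trans[OF _ Suc.IH[OF z(1)]] by fastforce
  qed
qed auto

lemma reach_within_restrict:
  "reach_within (E \<inter> X \<times> X) X n x y \<longleftrightarrow> reach_within E X n x y"
  by (induction n arbitrary: y) (auto dest: reach_within_in)

text \<open>All vertices of the walk lie within distance \<open>n\<close> of \<open>x\<close>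
  themselves. Hence a ball induces a subgraph of radius at most \<open>n\<close> and can serve as a
  branch set.\<close>

lemma reach_within_ball:
  assumes "reach_within E X n x y"
  shows "reach_within E {z. reach_within E X n x z} n x y"
proof -
  have "m \<le> n \<Longrightarrow> reach_within E X m x y \<Longrightarrow> reach_within E {z. reach_within E X n x z} m x y" for m
  proof (induction m arbitrary: y)
    case 0
    then show ?case by (auto intro: reach_within_refl)
  next
    case (Suc m)
    then show ?case using reach_within_mono[OF Suc.prems(2,1) subset_refl] by auto
  qed
  then show ?thesis using assms by blast
qed

text \<open>Each step of the walk adds at most one vertex, so \<open>Q\<close> collects the vertices
  other than \<open>v\<close>. Used to bound how many vertices one connection consumes.\<close>

lemma reach_within_small_set:
  assumes "reach_within E X n v x"
  shows "\<exists>Q\<subseteq>X - {v}. finite Q \<and> card Q \<le> n \<and> x \<in> insert v Q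
           \<and> (\<forall>z\<in>Q. reach_within E (insert v Q) n v z)"
  using assms
proof (induction n arbitrary: x)
  case 0
  then show ?case by (intro exI[of _ "{}"]) auto
next
  case (Suc n)
  obtain z where z: "reach_within E X n v z" "z = x \<or> (z, x) \<in> E \<and> x \<in> X"
    using Suc.prems by auto
  obtain Q where Q: "Q \<subseteq> X - {v}" "finite Q" "card Q \<le> n" "z \<in> insert v Q"
    "\<forall>z\<in>Q. reach_within E (insert v Q) n v z"
    using Suc.IH[OF z(1)] by blast
  show ?case
  proof (cases "x \<in> insert v Q")
    case True
    then show ?thesis using Q by (intro exI[of _ Q]) auto
  next
    case False
    with z Q have zx: "(z, x) \<in> E" "x \<in> X" by auto
    have "reach_within E (insert v Q) n v z" 
      using Q(4,5) by (auto intro: reach_within_refl)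
    then have "reach_within E (insert v (insert x Q)) n v z"
      by (rule reach_within_mono) auto
    then have "reach_within E (insert v (insert x Q)) (Suc n) v x" using zx by auto
    moreover have "reach_within E (insert v (insert x Q)) (Suc n) v y" if "y \<in> Q" for y
      by (rule reach_within_mono[OF Q(5)[rule_format, OF that]]) auto
    ultimately show ?thesis
      using Q False zx by (intro exI[of _ "insert x Q"]) auto
  qed
qed

text \<open>After its last visit to \<open>v\<close> the walk from \<open>v\<close> to
  \<open>x\<close> stays in \<open>W\<close>. Reversed, this part extends the walk from
  \<open>u\<close> up to a neighbour of \<open>v\<close> without passing through \<open>v\<close>;
  the set \<open>X\<close> may therefore exclude \<open>v\<close>.\<close>

lemma reach_within_last_edge:
  assumes "sym E" "reach_within E (insert v W) n v x" "x \<noteq> v" "reach_within E X m u x" "W \<subseteq> X"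
  shows "\<exists>y. reach_within E X (m + n) u y \<and> (y, v) \<in> E"
  using assms(2-4)
proof (induction n arbitrary: m x)
  case (Suc n)
  show ?case
  proof (cases "reach_within E (insert v W) n v x")
    case True
    then obtain y where "reach_within E X (m + n) u y" "(y, v) \<in> E"
      using Suc.IH Suc.prems by blast
    then show ?thesis by auto
  next
    case False
    then obtain z where z: "reach_within E (insert v W) n v z" "(z, x) \<in> E"
      using Suc.prems by auto
    then have xz: "(x, z) \<in> E" using \<open>sym E\<close> by (auto dest: symD)
    show ?thesis
    proof (cases "z = v")
      case True
      then show ?thesis
        using xz reach_within_mono[OF Suc.prems(3) _ subset_refl, of "m + Suc n"] by auto
    next
      case False
      then have "z \<in> X" using reach_within_in[OF z(1)] assms(5) by auto
      then show ?thesis using Suc.IH[OF z(1) False, of "Suc m"] xz Suc.prems(3) by auto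
    qed
  qed
qed auto

text \<open>The second case cuts the walk at a visit to \<open>Z\<close>. The strict
  \<open>j < n\<close> is what lets weakly reachable sets be bounded by induction on the
  radius.\<close>

lemma reach_within_avoid_or_hit:
  assumes "reach_within E X n v y"
  shows "reach_within E (insert v (X - Z)) n v y \<or> (\<exists>z\<in>Z. \<exists>j<n. reach_within E X j z y)"
  using assms
proof (induction n arbitrary: y)
  case (Suc n)
  show ?case
  proof (cases "reach_within E X n v y")
    case True
    then show ?thesis using Suc.IH less_SucI by (metis reach_within.simps(2))
  next
    case False
    then obtain z where z: "reach_within E X n v z" "(z, y) \<in> E" "y \<in> X"
      using Suc.prems by auto
    consider "reach_within E (insert v (X - Z)) n v z" | z' j where "z' \<in> Z" "j < n" "reach_within E X j z' z"
      using Suc.IH[OF z(1)] by blast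
    then show ?thesis
    proof cases
      case 1
      show ?thesis
      proof (cases "y \<in> Z")
        case True
        then show ?thesis using z(3) by (intro disjI2 bexI[of _ y] exI[of _ 0]) auto
      next
        case False
        then show ?thesis using 1 z by auto
      qed
    next
      case 2
      then have "reach_within E X (Suc j) z' y" using z by auto
      then show ?thesis using 2 Suc_less_eq by blast
    qed
  qed
qed auto

section \<open>Graph distance, and edge bounds from shallow minors\<close>

lemma awalk_iff_reach_within:
  assumes "pair_wf_digraph G"
  shows "(\<exists>p. pre_digraph.awalk (with_proj G) u p v \<and> length p \<le> n)
           \<longleftrightarrow> reach_within (parcs G) (pverts G) n u v"
proof -
  interpret pair_wf_digraph G by fact
  show ?thesis
  proof
    assume "\<exists>p. awalk u p v \<and> length p \<le> n"
    then obtain p where p: "awalk u p v" "length p \<le> n" by blast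
    have "reach_within (parcs G) (pverts G) (length p) u v"
      using p(1)
    proof (induction p arbitrary: v rule: rev_induct)
      case Nil
      then show ?case by (auto simp: awalk_Nil_iff)
    next
      case (snoc e p)
      then have "awalk u p (fst e)" "awalk (fst e) [e] v" by (auto simp: awalk_Cons_iff awalk_Nil_iff)
      moreover from this(2) have "e = (fst e, v)" "e \<in> parcs G" "v \<in> pverts G"
        by (auto simp: awalk_Cons_iff awalk_Nil_iff)
      ultimately show ?case using snoc.IH by (metis length_append_singleton reach_within_step)
    qed
    then show "reach_within (parcs G) (pverts G) n u v"
      using p(2) by (rule reach_within_mono) auto
  next
    show "reach_within (parcs G) (pverts G) n u v \<Longrightarrow> \<exists>p. awalk u p v \<and> length p \<le> n"
    proof (induction n arbitrary: v)
      case 0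
      then show ?case by (auto simp: awalk_Nil_iff)
    next
      case (Suc n)
      show ?case
      proof (cases "reach_within (parcs G) (pverts G) n u v")
        case True
        then show ?thesis using Suc.IH le_SucI by blast
      next
        case False
        then obtain z where z: "reach_within (parcs G) (pverts G) n u z" "(z, v) \<in> parcs G" "v \<in> pverts G"
          using Suc.prems by auto
        then obtain p where "awalk u p z" "length p \<le> n" using Suc.IH by blast
        moreover have "awalk z [(z, v)] v" using z by (auto simp: awalk_Cons_iff awalk_Nil_iff)
        ultimately have "awalk u (p @ [(z, v)]) v" "length (p @ [(z, v)]) \<le> Suc n" by auto
        then show ?thesis by blast
      qed
    qed
  qed
qed

lemma gdist_le_iff_reach_within:
  assumes "pair_wf_digraph G"
  shows "gdist G u v \<le> ereal (real n) \<longleftrightarrow> reach_within (parcs G) (pverts G) n u v"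
  using assms by (simp add: gdist_le_iff awalk_iff_reach_within)

text \<open>Packages the density hypothesis for counting: the minor has the centres of its branch
  sets as vertices, and each branch set induces its subgraph. \<open>A\<close> holds both arcs of
  every edge, so \<open>card A / card S\<close> is the average degree.\<close>

lemma depth_minor_card_arcs_le:
  assumes G: "pair_graph G" and nab: "nabla n G \<le> real c"
    and S: "finite S"
    and A: "A \<subseteq> S \<times> S" "sym A" "irrefl A"
    and B: "\<And>v. v \<in> S \<Longrightarrow> v \<in> B v \<and> B v \<subseteq> pverts G"
    and reach: "\<And>v x. v \<in> S \<Longrightarrow> x \<in> B v \<Longrightarrow> reach_within (parcs G) (B v) n v x"
    and disj: "\<And>u v. u \<in> S \<Longrightarrow> v \<in> S \<Longrightarrow> u \<noteq> v \<Longrightarrow> B u \<inter> B v = {}"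
    and edge: "\<And>u v. (u, v) \<in> A \<Longrightarrow> \<exists>x\<in>B u. \<exists>y\<in>B v. (x, y) \<in> parcs G"
  shows "card A \<le> c * card S"
proof -
  interpret G: pair_graph G by fact
  define H where "H = \<lparr>pverts = S, parcs = A\<rparr>"
  define \<eta> where "\<eta> v = \<lparr>pverts = B v, parcs = parcs G \<inter> B v \<times> B v\<rparr>" for v
  have symE: "sym (parcs G)" by (auto intro!: symI dest: G.arcs_symmetric)
  have "finite A" using A(1) S finite_subset by blast
  have H: "pair_graph H"
    using A S \<open>finite A\<close> unfolding H_def
    by unfold_locales (auto simp: symmetric_def irrefl_def)
  then interpret H: pair_graph H .
  have \<eta>g: "pair_graph (\<eta> v)" if "v \<in> S" for v
  proof
    show "finite (pverts (\<eta> v))" "finite (parcs (\<eta> v))"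
      using B[OF that] G.pair_finite_verts G.pair_finite_arcs
      by (auto simp: \<eta>_def intro: finite_subset)
    show "symmetric (with_proj (\<eta> v))"
      unfolding symmetric_def \<eta>_def using symE by (auto intro!: symI dest: symD)
  qed (auto simp: \<eta>_def G.no_loops')
  have reach': "reach_within (parcs (\<eta> v)) (pverts (\<eta> v)) n v x" if "v \<in> S" "x \<in> B v" for v x
    using reach[OF that] unfolding \<eta>_def by (simp add: reach_within_restrict)
  have "depth_minor_model n H G \<eta>"
    unfolding depth_minor_model_def
  proof (intro conjI ballI impI)
    fix v assume "v \<in> pverts H"
    then have v: "v \<in> S" by (simp add: H_def)
    interpret e: pair_graph "\<eta> v" by (rule \<eta>g[OF v])
    show "pair_graph (\<eta> v)" by (rule \<eta>g[OF v])
    show "subgraph (with_proj (\<eta> v)) (with_proj G)"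
      unfolding subgraph_def compatible_def using B[OF v]
      by (auto simp: \<eta>_def[of v] G.wf_digraph e.wf_digraph[unfolded \<eta>_def])
    have wf: "pair_wf_digraph (\<eta> v)" by unfold_locales
    have walk: "\<exists>p. e.awalk v p x \<and> length p \<le> n" if "x \<in> B v" for x
      using reach'[OF v that] awalk_iff_reach_within[OF wf] by blast
    have "pverts (\<eta> v) \<noteq> {}" using B[OF v] by (auto simp: \<eta>_def)
    moreover have "\<forall>x\<in>pverts (\<eta> v). gdist (\<eta> v) v x \<le> ereal (real n)"
      using reach'[OF v] by (auto simp: \<eta>_def gdist_le_iff_reach_within[OF wf, unfolded \<eta>_def])
    ultimately show "gradius (\<eta> v) \<le> ereal (real n)"
      using gradius_le_iff[of "\<eta> v"] e.pair_finite_verts B[OF v] by (auto simp: \<eta>_def)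
    have r: "v \<rightarrow>\<^sup>*\<^bsub>with_proj (\<eta> v)\<^esub> x" if "x \<in> B v" for x
      using walk[OF that] e.reachable_awalkI by blast
    have "x \<rightarrow>\<^sup>*\<^bsub>with_proj (\<eta> v)\<^esub> y" if "x \<in> B v" "y \<in> B v" for x y
      using e.reachable_trans[OF e.symmetric_reachable'[OF r[OF that(1)]] r[OF that(2)]] .
    then show "connected (with_proj (\<eta> v))"
      unfolding connected_def strongly_connected_def e.reachable_mk_symmetric_eq[OF e.sym_arcs]
      using B[OF v] by (auto simp: \<eta>_def)
  next
    fix u v assume "u \<in> pverts H" "v \<in> pverts H" "u \<noteq> v"
    then show "pverts (\<eta> u) \<inter> pverts (\<eta> v) = {}" using disj by (simp add: H_def \<eta>_def)
  next
    fix e assume "e \<in> parcs H"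
    then show "case e of (u, v) \<Rightarrow> \<exists>x\<in>pverts (\<eta> u). \<exists>y\<in>pverts (\<eta> v). (x, y) \<in> parcs G"
      using edge by (auto simp: H_def \<eta>_def)
  qed
  then have "depth_minor n H G" using H unfolding depth_minor_def by blast
  then have "avg_degree H \<le> real c" using avg_degree_le_nabla[OF G] nab by fastforce
  then have le: "real (card A) / real (card S) \<le> real c"
    by (simp add: avg_degree_eq[OF H.pair_fin_digraph]) (simp add: H_def)
  show ?thesis
  proof (cases "S = {}")
    case True
    then show ?thesis using A(1) by auto
  next
    case False
    then have "real (card S) > 0" using S by (simp add: card_gt_0_iff)
    then have "real (card A) \<le> real c * real (card S)" using le by (simp add: divide_le_eq)
    then show ?thesis by (metis of_nat_le_iff of_nat_mult)
  qed
qed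

text \<open>
  A maximal family of internally disjoint short connections between vertices of \<open>S\<close> is linear in
  size, as it yields a shallow minor on \<open>S\<close>. If no vertex of \<open>S\<close> were separable, then the balls
  around the vertices of a large independent set \<open>R\<close> of that minor, taken in the complement of the
  set \<open>U\<close> of used vertices, would be disjoint and each adjacent to many vertices of \<open>U\<close>: a shallow
  minor that is too dense.
\<close>

lemma exists_separable_vertex:
  fixes G :: "'a pair_pre_digraph" and r c :: nat
  assumes G: "pair_graph G" and nab: "nabla (2 * r) G \<le> real c"
    and S: "S \<subseteq> pverts G" "S \<noteq> {}"
  shows "\<exists>v\<in>S. \<exists>Z\<subseteq>pverts G. v \<notin> Z \<and> card Z \<le> 2 * c + c * (1 + 2 * r * c * (2 * c + 1))
           \<and> (\<forall>y\<in>S. reach_within (parcs G) (pverts G - Z) r v y \<longrightarrow> y = v)"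
proof (rule ccontr)
  define V where "V = pverts G"
  define E where "E = parcs G"
  define k where "k = 2 * c + c * (1 + 2 * r * c * (2 * c + 1))"
  assume "\<not> ?thesis"
  then have no_sep: "\<exists>y\<in>S. y \<noteq> v \<and> reach_within E (V - Z) r v y"
    if "v \<in> S" "Z \<subseteq> V" "v \<notin> Z" "card Z \<le> k" for v Z
    using that unfolding V_def E_def k_def by blast
  interpret G: pair_graph G by fact
  have finV: "finite V" unfolding V_def by (rule G.pair_finite_verts)
  have SV: "S \<subseteq> V" using S V_def by simp
  have finS: "finite S" using SV finV finite_subset by blast
  have symE: "sym E" unfolding E_def by (auto intro!: symI dest: G.arcs_symmetric)
  have EV: "x \<in> V" "y \<in> V" if "(x, y) \<in> E" for x y
    using that G.in_arcsD1 G.in_arcsD2 unfolding V_def E_def by blast+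

  \<comment> \<open>\<open>Q\<close> is the interior of a connection from \<open>v\<close> to
    \<open>y\<close>, hanging entirely on \<open>v\<close>: it will join the branch set of
    \<open>v\<close>, which is why the family \<open>D\<close> is oriented. One bound
    \<open>2 * r\<close> limits the number of used vertices, the other the depth of the branch
    sets.\<close>
  define link where "link v y Q \<longleftrightarrow> Q \<subseteq> V - S \<and> card Q \<le> 2 * r
      \<and> (\<forall>x\<in>Q. reach_within E (insert v Q) (2 * r) v x) \<and> (\<exists>x\<in>insert v Q. (x, y) \<in> E)" for v y Q
  define good where "good D q \<longleftrightarrow> D \<subseteq> S \<times> S \<and> (\<forall>v. (v, v) \<notin> D)
      \<and> (\<forall>v y. (v, y) \<in> D \<longrightarrow> (y, v) \<notin> D \<and> link v y (q (v, y)))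
      \<and> (\<forall>e\<in>D. \<forall>e'\<in>D. e \<noteq> e' \<longrightarrow> q e \<inter> q e' = {})"
    for D :: "('a \<times> 'a) set" and q :: "'a \<times> 'a \<Rightarrow> 'a set"
  have "good {} (\<lambda>_. {})" by (simp add: good_def)
  moreover have "\<forall>D. (\<exists>q. good D q) \<longrightarrow> card D < Suc (card (S \<times> S))"
    using finS card_mono[of "S \<times> S"] unfolding good_def less_Suc_eq_le by (metis finite_cartesian_product)
  ultimately obtain D where "\<exists>q. good D q" and Dmax: "\<And>D'. \<exists>q. good D' q \<Longrightarrow> card D' \<le> card D"
    using ex_has_greatest_nat[of "\<lambda>D. \<exists>q. good D q" "{}" card] by blast
  then obtain q where good: "good D q" by blast
  have DS: "D \<subseteq> S \<times> S" and Dirr: "\<And>v. (v, v) \<notin> D" and Dasym: "\<And>v y. (v, y) \<in> D \<Longrightarrow> (y, v) \<notin> D"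
    and Dlink: "\<And>v y. (v, y) \<in> D \<Longrightarrow> link v y (q (v, y))"
    and Ddisj: "\<And>e e'. e \<in> D \<Longrightarrow> e' \<in> D \<Longrightarrow> e \<noteq> e' \<Longrightarrow> q e \<inter> q e' = {}"
    using good unfolding good_def by blast+
  have finD: "finite D" using DS finS finite_subset by blast
  define U where "U = (\<Union>e\<in>D. q e)"
  define W where "W = V - S - U"
  define H where "H = D \<union> D\<inverse>"
  define N where "N v = {y. (v, y) \<in> H}" for v
  have qS: "q e \<subseteq> V - S" and qcard: "card (q e) \<le> 2 * r" if "e \<in> D" for e
    using Dlink[of "fst e" "snd e"] that unfolding link_def by auto
  have UV: "U \<subseteq> V - S" using qS unfolding U_def by blast
  have finU: "finite U" using UV finV finite_subset by blast
  have HS: "H \<subseteq> S \<times> S" using DS unfolding H_def by auto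
  have Hsym: "sym H" unfolding H_def sym_def by auto
  have Hirr: "irrefl H" unfolding H_def irrefl_def using Dirr by auto
  have finH: "finite H" unfolding H_def using finD by simp

  \<comment> \<open>Otherwise the vertices of this walk, none of them used so far, would link
    \<open>v\<close> to \<open>y\<close> and enlarge \<open>D\<close> beyond its maximum.\<close>
  have adj: "(v, y) \<in> H"
    if v: "v \<in> S" "y \<in> S" "v \<noteq> y" and reach: "reach_within E (insert v W) n v x" "n \<le> 2 * r" "(x, y) \<in> E"
    for v y x n
  proof (rule ccontr)
    assume notH: "(v, y) \<notin> H"
    obtain Q where Q: "Q \<subseteq> insert v W - {v}" "finite Q" "card Q \<le> n" "x \<in> insert v Q"
        "\<And>z. z \<in> Q \<Longrightarrow> reach_within E (insert v Q) n v z"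
      using reach_within_small_set[OF reach(1)] by blast
    have QW: "Q \<subseteq> W" using Q(1) by blast
    have "link v y Q"
      unfolding link_def
    proof (intro conjI ballI)
      show "Q \<subseteq> V - S" using QW unfolding W_def by blast
      show "card Q \<le> 2 * r" using Q(3) reach(2) by simp
      show "\<exists>x\<in>insert v Q. (x, y) \<in> E" using Q(4) reach(3) by blast
      fix z assume "z \<in> Q"
      then show "reach_within E (insert v Q) (2 * r) v z"
        using reach_within_mono[OF Q(5) reach(2) subset_refl] by blast
    qed
    moreover have notD: "(v, y) \<notin> D" "(y, v) \<notin> D" using notH unfolding H_def by auto
    moreover have "Q \<inter> q e = {}" if "e \<in> D" for e
      using QW that unfolding W_def U_def by blast
    ultimately have "good (insert (v, y) D) (q((v, y) := Q))"
      using v DS Dirr Dasym Dlink Ddisj unfolding good_def by (auto simp: Int_commute)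
    then have "card (insert (v, y) D) \<le> card D" using Dmax by blast
    then show False using notD finD by simp
  qed

  \<comment> \<open>Each \<open>v\<close> absorbs the connections oriented away from it; these avoid
    \<open>S\<close> and are pairwise disjoint, so contracting them realizes
    \<open>H\<close>.\<close>
  have cardH: "card H \<le> c * card S"
  proof (rule depth_minor_card_arcs_le[OF G nab finS HS Hsym Hirr])
    define B where "B v = insert v (\<Union>y\<in>{y. (v, y) \<in> D}. q (v, y))" for v
    show "v \<in> B v \<and> B v \<subseteq> pverts G" if "v \<in> S" for v
      using that SV qS unfolding B_def V_def[symmetric] by blast
    show "reach_within (parcs G) (B v) (2 * r) v x" if v: "v \<in> S" "x \<in> B v" for v x
    proof (cases "x = v")
      case True
      then show ?thesis using v by (auto intro: reach_within_refl)
    next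
      case False
      then obtain y where y: "(v, y) \<in> D" "x \<in> q (v, y)" using v unfolding B_def by blast
      then have "reach_within E (insert v (q (v, y))) (2 * r) v x"
        using Dlink unfolding link_def by blast
      then show ?thesis
        unfolding E_def by (rule reach_within_mono) (use y in \<open>auto simp: B_def\<close>)
    qed
    show "B u \<inter> B v = {}" if "u \<in> S" "v \<in> S" "u \<noteq> v" for u v
    proof -
      have "q (u, y) \<inter> q (v, z) = {}" if "(u, y) \<in> D" "(v, z) \<in> D" for y z
        using Ddisj[OF that] \<open>u \<noteq> v\<close> by blast
      moreover have "u \<notin> q e" "v \<notin> q e" if "e \<in> D" for e
        using qS[OF that] \<open>u \<in> S\<close> \<open>v \<in> S\<close> by blast+
      ultimately show ?thesis using \<open>u \<noteq> v\<close> unfolding B_def by blast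
    qed
    have D: "\<exists>x\<in>B u. (x, v) \<in> E" if "(u, v) \<in> D" for u v
      using Dlink[OF that] that unfolding link_def B_def by blast
    have self: "v \<in> B v" for v unfolding B_def by simp
    show "\<exists>x\<in>B u. \<exists>y\<in>B v. (x, y) \<in> parcs G" if "(u, v) \<in> H" for u v
    proof (cases "(u, v) \<in> D")
      case True
      then show ?thesis using D self unfolding E_def by blast
    next
      case False
      then have "(v, u) \<in> D" using that unfolding H_def by blast
      then obtain x where "x \<in> B v" "(x, u) \<in> E" using D by blast
      then show ?thesis using self symE unfolding E_def by (meson symE symD)
    qed
  qed
  have "card H = card D + card (D\<inverse>)"
    unfolding H_def using finD Dasym by (intro card_Un_disjoint) auto
  then have cardD: "2 * card D \<le> c * card S" using cardH by simp
  have "card U \<le> (\<Sum>e\<in>D. card (q e))" unfolding U_def by (rule card_UN_le[OF finD])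
  also have "\<dots> \<le> (\<Sum>e\<in>D. 2 * r)" by (rule sum_mono) (rule qcard)
  also have "\<dots> = r * (2 * card D)" by simp
  also have "\<dots> \<le> r * (c * card S)" using cardD by (rule mult_le_mono2)
  finally have cardU: "card U \<le> r * c * card S" by (simp add: mult.assoc)

  define T where "T v = {u\<in>U. \<exists>x. reach_within E (insert v W) r v x \<and> (x, u) \<in> E}" for v
  have NS: "N v \<subseteq> S" for v using HS unfolding N_def by blast
  have finN: "finite (N v)" for v using NS finS finite_subset by blast
  have finT: "finite (T v)" for v using finU unfolding T_def by simp
  \<comment> \<open>Otherwise \<open>N v \<union> T v\<close> would separate \<open>v\<close>: a
    walk of length at most \<open>r\<close> that avoids it never leaves \<open>insert v W\<close>,
    as entering \<open>S - {v}\<close> is excluded by \<open>adj\<close> and entering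
    \<open>U\<close> by the definition of \<open>T\<close>.\<close>
  have large: "k < card (N v) + card (T v)" if v: "v \<in> S" for v
  proof (rule ccontr)
    assume "\<not> k < card (N v) + card (T v)"
    then have "card (N v \<union> T v) \<le> k" using card_Un_le[of "N v" "T v"] by linarith
    moreover have "N v \<union> T v \<subseteq> V" using NS SV UV unfolding T_def by blast
    moreover have "v \<notin> N v \<union> T v" using Hirr UV v unfolding N_def T_def irrefl_def by blast
    ultimately obtain y where y: "y \<in> S" "y \<noteq> v" "reach_within E (V - (N v \<union> T v)) r v y"
      using no_sep[OF v, of "N v \<union> T v"] by blast
    have "n \<le> r \<Longrightarrow> reach_within E (V - (N v \<union> T v)) n v x \<Longrightarrow> reach_within E (insert v W) n v x" for n x
    proof (induction n arbitrary: x)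
      case (Suc n)
      show ?case
      proof (cases "reach_within E (V - (N v \<union> T v)) n v x")
        case True
        then show ?thesis using Suc by simp
      next
        case False
        then obtain z where z: "reach_within E (V - (N v \<union> T v)) n v z" "(z, x) \<in> E"
            "x \<in> V - (N v \<union> T v)"
          using Suc.prems by auto
        have reach: "reach_within E (insert v W) n v z" using Suc.IH Suc.prems(1) z(1) by simp
        have "x \<in> S \<Longrightarrow> x = v"
          using adj[OF v _ _ reach _ z(2)] z(3) Suc.prems(1) unfolding N_def by auto
        moreover have "x \<notin> U"
        proof
          assume "x \<in> U"
          moreover have "reach_within E (insert v W) r v z"
            by (rule reach_within_mono[OF reach _ subset_refl]) (use Suc.prems(1) in simp)
          ultimately show False using z(2,3) unfolding T_def by blast
        qed
        ultimately have "x \<in> insert v W" using z(3) unfolding W_def by blast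
        then show ?thesis using reach z(2) by auto
      qed
    qed auto
    then have "y \<in> insert v W" using y(3) reach_within_in by fastforce
    then show False using y(1,2) unfolding W_def by blast
  qed

  \<comment> \<open>The average degree in \<open>H\<close> is at most \<open>c\<close>, so vertices
    of degree above \<open>2 * c\<close> make up at most half of \<open>S\<close>.\<close>
  define L where "L = {v\<in>S. card (N v) \<le> 2 * c}"
  have finL: "finite L" using finS unfolding L_def by simp
  have "H = Sigma S N" using HS unfolding N_def by auto
  then have "card H = (\<Sum>v\<in>S. card (N v))" using finS finN by simp
  also have "\<dots> \<ge> (\<Sum>v\<in>S - L. card (N v))" using finS by (intro sum_mono2) auto
  finally have "(\<Sum>v\<in>S - L. card (N v)) \<le> c * card S" using cardH by simp
  moreover have "(\<Sum>v\<in>S - L. 2 * c + 1) \<le> (\<Sum>v\<in>S - L. card (N v))"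
    by (intro sum_mono) (auto simp: L_def)
  ultimately have "(2 * c + 1) * card (S - L) \<le> c * card S" by (simp add: mult.commute)
  moreover have "card S = card L + card (S - L)"
  proof -
    have "L \<subseteq> S" unfolding L_def by blast
    then show ?thesis using finS finL card_mono[of S L] by (simp add: card_Diff_subset)
  qed
  ultimately have "(2 * c + 1) * card (S - L) \<le> c * card L + c * card (S - L)"
    by (simp add: distrib_left)
  then have "(c + 1) * card (S - L) \<le> c * card L" by (simp add: algebra_simps)
  then have "(c + 1) * card (S - L) \<le> (c + 1) * card L" by (simp add: algebra_simps)
  then have "card (S - L) \<le> card L" by (metis Suc_eq_plus1 Suc_mult_le_cancel1)
  then have cardL: "card S \<le> 2 * card L" using \<open>card S = card L + card (S - L)\<close> by simp

  \<comment> \<open>Independence in \<open>H\<close> will keep the balls disjoint. Low degree keeps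
    a maximum \<open>R\<close> large: closed neighbourhoods of at most \<open>2 * c + 1\<close>
    vertices cover \<open>L\<close>.\<close>
  define ind where "ind R \<longleftrightarrow> R \<subseteq> L \<and> (\<forall>u\<in>R. \<forall>v\<in>R. (u, v) \<notin> H)" for R
  have "ind {}" unfolding ind_def by simp
  moreover have "\<forall>R. ind R \<longrightarrow> card R < Suc (card L)"
    using finL by (auto simp: ind_def less_Suc_eq_le intro!: card_mono)
  ultimately obtain R where R: "ind R" and Rmax: "\<And>R'. ind R' \<Longrightarrow> card R' \<le> card R"
    using ex_has_greatest_nat[of ind "{}" card] by blast
  have RL: "R \<subseteq> L" and Rind: "\<And>u v. u \<in> R \<Longrightarrow> v \<in> R \<Longrightarrow> (u, v) \<notin> H"
    using R unfolding ind_def by blast+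
  have finR: "finite R" using RL finL finite_subset by blast
  have RS: "R \<subseteq> S" using RL unfolding L_def by blast
  have cov: "L \<subseteq> (\<Union>v\<in>R. insert v (N v))"
  proof (rule ccontr)
    assume "\<not> ?thesis"
    then obtain x where x: "x \<in> L" "x \<notin> R" "\<And>v. v \<in> R \<Longrightarrow> (v, x) \<notin> H" unfolding N_def by blast
    moreover have "(x, v) \<notin> H" if "v \<in> R" for v using x(3)[OF that] Hsym by (meson symD)
    ultimately have "ind (insert x R)"
      using RL Rind Hirr unfolding ind_def irrefl_def by blast
    then show False using Rmax[of "insert x R"] x finR by simp
  qed
  have "card L \<le> card (\<Union>v\<in>R. insert v (N v))"
    using finR finN cov by (intro card_mono) auto
  also have "\<dots> \<le> (\<Sum>v\<in>R. card (insert v (N v)))" by (rule card_UN_le[OF finR])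
  also have "\<dots> \<le> (\<Sum>v\<in>R. 2 * c + 1)"
  proof (rule sum_mono)
    fix v assume "v \<in> R"
    then have "card (N v) \<le> 2 * c" using RL unfolding L_def by blast
    then show "card (insert v (N v)) \<le> 2 * c + 1" using card_insert_le_m1[of "2 * c + 1" "N v" v] by simp
  qed
  finally have cardR: "card L \<le> (2 * c + 1) * card R" by (simp add: mult.commute)
  have "card S > 0" using S(2) finS by (simp add: card_gt_0_iff)
  then have Rpos: "card R > 0" using cardL cardR by (cases "card R") auto

  \<comment> \<open>The second minor joins the balls around \<open>R\<close> to the single vertices
    of \<open>U\<close>.\<close>
  define A where "A = Sigma R T \<union> (Sigma R T)\<inverse>"
  have TU: "T v \<subseteq> U" for v unfolding T_def by blast
  have RU: "R \<inter> U = {}" using RS UV by blast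
  have cardA: "card A \<le> c * card (R \<union> U)"
  proof (rule depth_minor_card_arcs_le[OF G nab])
    define B where "B v = (if v \<in> R then {z. reach_within E (insert v W) r v z} else {v})" for v
    show "finite (R \<union> U)" using finR finU by simp
    show "A \<subseteq> (R \<union> U) \<times> (R \<union> U)" using TU unfolding A_def by blast
    show "sym A" unfolding A_def sym_def by auto
    show "irrefl A" unfolding A_def irrefl_def using TU RU by auto
    have BW: "B v \<subseteq> insert v W" for v
      unfolding B_def by (auto dest: reach_within_in)
    have WV: "W \<subseteq> V" unfolding W_def by blast
    show "v \<in> B v \<and> B v \<subseteq> pverts G" if "v \<in> R \<union> U" for v
    proof
      show "v \<in> B v" by (simp add: B_def reach_within_refl)
      show "B v \<subseteq> pverts G" using BW[of v] that RS SV UV WV unfolding V_def[symmetric] by blast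
    qed
    show "reach_within (parcs G) (B v) (2 * r) v x" if "v \<in> R \<union> U" "x \<in> B v" for v x
    proof (cases "v \<in> R")
      case True
      then have "reach_within E (B v) r v x"
        using that reach_within_ball unfolding B_def by fastforce
      then show ?thesis unfolding E_def by (rule reach_within_mono) auto
    next
      case False
      then show ?thesis using that by (auto simp: B_def intro: reach_within_refl)
    qed
    have disjR: "B u \<inter> B v = {}" if uv: "u \<in> R" "v \<in> R" "u \<noteq> v" for u v
    proof (rule ccontr)
      assume "B u \<inter> B v \<noteq> {}"
      then obtain x where x: "reach_within E (insert u W) r u x" "reach_within E (insert v W) r v x"
        using uv unfolding B_def by auto
      have "x \<noteq> v" using x(1) reach_within_in uv RS unfolding W_def by fastforce
      then obtain y where "reach_within E (insert u W) (r + r) u y" "(y, v) \<in> E"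
        using reach_within_last_edge[OF symE x(2) _ x(1)] by blast
      then have "(u, v) \<in> H" using adj[of u v "r + r" y] uv RS by auto
      then show False using Rind uv by blast
    qed
    have "B u \<inter> B v = {}" if uv: "u \<in> U" "v \<in> R \<union> U" "u \<noteq> v" for u v
      using BW[of v] uv RU unfolding B_def W_def by auto
    then show "B u \<inter> B v = {}" if uv: "u \<in> R \<union> U" "v \<in> R \<union> U" "u \<noteq> v" for u v
      using disjR uv by (metis Un_iff inf_commute)
    have arc: "\<exists>x\<in>B v. \<exists>y\<in>B u. (x, y) \<in> E" if "v \<in> R" "u \<in> T v" for u v
      using that RU unfolding T_def B_def by auto
    show "\<exists>x\<in>B u. \<exists>y\<in>B v. (x, y) \<in> parcs G" if "(u, v) \<in> A" for u v
    proof -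
      consider "u \<in> R" "v \<in> T u" | "v \<in> R" "u \<in> T v" using \<open>(u, v) \<in> A\<close> unfolding A_def by auto
      then show ?thesis
        by cases (use arc symE in \<open>unfold E_def, blast, meson symD\<close>)
    qed
  qed
  have "card A = card (Sigma R T) + card ((Sigma R T)\<inverse>)"
    unfolding A_def using finR finT TU RU by (intro card_Un_disjoint) auto
  also have "\<dots> = 2 * (\<Sum>v\<in>R. card (T v))" using finR finT by simp
  finally have A: "card A = 2 * (\<Sum>v\<in>R. card (T v))" .
  \<comment> \<open>Chosen so that \<open>card R + card U \<le> M * card R\<close>. Then
    \<open>k = 2 * c + c * M\<close> leaves more than \<open>c * M\<close> vertices in
    \<open>T v\<close> once at most \<open>2 * c\<close> are spent on \<open>N v\<close>.\<close>
  define M where "M = 1 + 2 * r * c * (2 * c + 1)"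
  have "(\<Sum>v\<in>R. c * M + 1) \<le> (\<Sum>v\<in>R. card (T v))"
  proof (rule sum_mono)
    fix v assume v: "v \<in> R"
    then have "card (N v) \<le> 2 * c" using RL unfolding L_def by blast
    then show "c * M + 1 \<le> card (T v)" using large[of v] v RS unfolding k_def M_def by auto
  qed
  then have "2 * ((c * M + 1) * card R) \<le> card A" using A by (simp add: mult.commute)
  also have "\<dots> \<le> c * (card R + card U)"
    using cardA card_Un_le[of R U] by (meson le_trans mult_le_mono2)
  also have "card U \<le> 2 * r * c * (2 * c + 1) * card R"
  proof -
    have "card S \<le> 2 * ((2 * c + 1) * card R)" using cardL cardR by linarith
    then have "r * c * card S \<le> r * c * (2 * ((2 * c + 1) * card R))" by (rule mult_le_mono2)
    then show ?thesis using cardU by (simp add: algebra_simps)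
  qed
  then have "c * (card R + card U) \<le> c * (M * card R)"
    unfolding M_def by (intro mult_le_mono2) (simp add: algebra_simps)
  finally have "2 * ((c * M + 1) * card R) \<le> c * M * card R" by (simp add: mult.assoc)
  then show False using Rpos by (simp add: algebra_simps)
qed

section \<open>Weak reachability\<close>

text \<open>Weak reachability as in the weak colouring numbers, with walks instead of paths, so that
  concatenation needs no shortcutting.\<close>

definition weak_reach :: "('a \<times> 'a) set \<Rightarrow> 'a set \<Rightarrow> ('a \<Rightarrow> nat) \<Rightarrow> nat \<Rightarrow> 'a \<Rightarrow> 'a \<Rightarrow> bool" where
  "weak_reach E V ord n v y \<longleftrightarrow> reach_within E {x \<in> V. ord y \<le> ord x} n v y"

lemma weak_reach_in:
  "weak_reach E V ord n v y \<Longrightarrow> v \<in> V \<and> y \<in> V \<and> ord y \<le> ord v"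
  unfolding weak_reach_def by (auto dest: reach_within_in)

lemma weak_reach_refl: "v \<in> V \<Longrightarrow> weak_reach E V ord n v v"
  unfolding weak_reach_def by (rule reach_within_refl) simp

lemma weak_reach_mono: "weak_reach E V ord m v y \<Longrightarrow> m \<le> n \<Longrightarrow> weak_reach E V ord n v y"
  unfolding weak_reach_def by (rule reach_within_mono) auto

lemma weak_reach_trans:
  assumes "weak_reach E V ord m x y" "weak_reach E V ord n y z"
  shows "weak_reach E V ord (m + n) x z"
proof -
  have "ord z \<le> ord y" using weak_reach_in[OF assms(2)] by simp
  then have "reach_within E {x \<in> V. ord z \<le> ord x} m x y"
    using assms(1) unfolding weak_reach_def by (elim reach_within_mono) auto
  then show ?thesis using assms(2) unfolding weak_reach_def by (rule reach_within_trans)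
qed

text \<open>Following the first walk backwards and then the second one meets nothing below
  \<open>z\<close>. Thus the vertices weakly reached from one source weakly reach each other, the
  lower from the higher.\<close>

lemma weak_reach_common_source:
  assumes "sym E" "weak_reach E V ord m v y" "weak_reach E V ord n v z" "ord z \<le> ord y"
  shows "weak_reach E V ord (m + n) y z"
proof -
  have "reach_within E {x \<in> V. ord z \<le> ord x} m v y"
    using assms(2,4) unfolding weak_reach_def by (elim reach_within_mono) auto
  from reach_within_trans[OF reach_within_sym[OF assms(1) this]] show ?thesis
    using assms(3) unfolding weak_reach_def by simp
qed

text \<open>The lowest vertex \<open>w\<close> of a walk cuts it into two weak walks. In the
  induction, a new endpoint below \<open>w\<close> takes its place.\<close>

lemma reach_within_iff_weak_reach:
  assumes "sym E"
  shows "reach_within E V n u v \<longleftrightarrow>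
           (\<exists>w i j. i + j \<le> n \<and> weak_reach E V ord i u w \<and> weak_reach E V ord j v w)"
proof
  show "reach_within E V n u v \<Longrightarrow>
      \<exists>w i j. i + j \<le> n \<and> weak_reach E V ord i u w \<and> weak_reach E V ord j v w"
  proof (induction n arbitrary: v)
    case 0
    then show ?case by (auto intro: weak_reach_refl)
  next
    case (Suc n)
    show ?case
    proof (cases "reach_within E V n u v")
      case True
      then show ?thesis using Suc.IH le_SucI by blast
    next
      case False
      then obtain z where z: "reach_within E V n u z" "(z, v) \<in> E" "v \<in> V" using Suc.prems by auto
      then obtain w i j where w: "i + j \<le> n" "weak_reach E V ord i u w" "weak_reach E V ord j z w"
        using Suc.IH by blast
      have zV: "z \<in> V" "ord w \<le> ord z" using weak_reach_in[OF w(3)] by auto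
      show ?thesis
      proof (cases "ord w \<le> ord v")
        case True
        then have "reach_within E {x \<in> V. ord w \<le> ord x} 1 v z"
          using z zV assms by (auto dest: symD)
        then have "weak_reach E V ord (1 + j) v w"
          using w(3) unfolding weak_reach_def by (rule reach_within_trans)
        then show ?thesis using w(1,2) by (intro exI[of _ w] exI[of _ i] exI[of _ "1 + j"]) auto
      next
        case False
        let ?X = "{x \<in> V. ord v \<le> ord x}"
        have "reach_within E ?X i u w" "reach_within E ?X j z w"
          using w(2,3) False unfolding weak_reach_def by (auto elim!: reach_within_mono)
        then have "reach_within E ?X (i + j) u z"
          by (rule reach_within_trans[OF _ reach_within_sym[OF assms]])
        then have "reach_within E ?X n u z" using w(1) by (rule reach_within_mono) simp
        then have "weak_reach E V ord (Suc n) u v" using z unfolding weak_reach_def by auto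
        then show ?thesis using weak_reach_refl[OF z(3)] by (intro exI[of _ v] exI[of _ "Suc n"] exI[of _ 0]) auto
      qed
    qed
  qed
next
  assume "\<exists>w i j. i + j \<le> n \<and> weak_reach E V ord i u w \<and> weak_reach E V ord j v w"
  then obtain w i j where w: "i + j \<le> n" "weak_reach E V ord i u w" "weak_reach E V ord j v w"
    by blast
  have "reach_within E V i u w" "reach_within E V j v w"
    using w(2,3) unfolding weak_reach_def by (auto elim!: reach_within_mono)
  then have "reach_within E V (i + j) u v"
    by (rule reach_within_trans[OF _ reach_within_sym[OF assms]])
  then show "reach_within E V n u v" using w(1) by (rule reach_within_mono) simp
qed

section \<open>Orders with small weakly reachable sets, and their colourings\<close>

lemma exists_separable_order:
  fixes V :: "'a set"
  assumes "finite V"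
    and sep: "\<And>S. S \<subseteq> V \<Longrightarrow> S \<noteq> {} \<Longrightarrow> \<exists>v\<in>S. \<exists>Z\<subseteq>V. v \<notin> Z \<and> card Z \<le> k
           \<and> (\<forall>y\<in>S. reach_within E (V - Z) r v y \<longrightarrow> y = v)"
  shows "\<exists>ord :: 'a \<Rightarrow> nat. inj_on ord V \<and> (\<forall>v\<in>V. \<exists>Z\<subseteq>V. v \<notin> Z \<and> card Z \<le> k
           \<and> (\<forall>y\<in>V. ord y \<le> ord v \<longrightarrow> reach_within E (V - Z) r v y \<longrightarrow> y = v))"
proof -
  have "S \<subseteq> V \<Longrightarrow> card S = n \<Longrightarrow> \<exists>ord :: 'a \<Rightarrow> nat. inj_on ord S \<and> (\<forall>v\<in>S. ord v < n)
      \<and> (\<forall>v\<in>S. \<exists>Z\<subseteq>V. v \<notin> Z \<and> card Z \<le> k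
           \<and> (\<forall>y\<in>S. ord y \<le> ord v \<longrightarrow> reach_within E (V - Z) r v y \<longrightarrow> y = v))" for S n
  proof (induction n arbitrary: S)
    case 0
    then have "S = {}" using assms(1) finite_subset by fastforce
    then show ?case by auto
  next
    case (Suc n)
    have finS: "finite S" using Suc.prems(1) assms(1) by (rule finite_subset)
    have "S \<noteq> {}" using Suc.prems(2) by auto
    then obtain v Z where v: "v \<in> S" "Z \<subseteq> V" "v \<notin> Z" "card Z \<le> k"
        "\<forall>y\<in>S. reach_within E (V - Z) r v y \<longrightarrow> y = v"
      using sep[OF Suc.prems(1)] by blast
    have "S - {v} \<subseteq> V" "card (S - {v}) = n" using Suc.prems v(1) finS by auto
    from Suc.IH[OF this] obtain ord :: "'a \<Rightarrow> nat" where ord: "inj_on ord (S - {v})"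
        "\<forall>u\<in>S - {v}. ord u < n"
        "\<forall>u\<in>S - {v}. \<exists>Z\<subseteq>V. u \<notin> Z \<and> card Z \<le> k
           \<and> (\<forall>y\<in>S - {v}. ord y \<le> ord u \<longrightarrow> reach_within E (V - Z) r u y \<longrightarrow> y = u)"
      by blast
    \<comment> \<open>The separable vertex goes on top, so that the vertices at or below it are
      exactly the set \<open>S\<close> from which it is separated.\<close>
    define ord' where "ord' = ord(v := n)"
    have "inj_on ord' S"
      using ord(1,2) unfolding ord'_def by (intro inj_onI) (auto simp: inj_on_eq_iff split: if_splits)
    moreover have "\<forall>u\<in>S. ord' u < Suc n" using ord(2) unfolding ord'_def by (auto intro: less_SucI)
    moreover have "\<exists>Z\<subseteq>V. u \<notin> Z \<and> card Z \<le> k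
        \<and> (\<forall>y\<in>S. ord' y \<le> ord' u \<longrightarrow> reach_within E (V - Z) r u y \<longrightarrow> y = u)" if u: "u \<in> S" for u
    proof (cases "u = v")
      case True
      then show ?thesis using v by blast
    next
      case False
      then obtain Z where Z: "Z \<subseteq> V" "u \<notin> Z" "card Z \<le> k"
          "\<forall>y\<in>S - {v}. ord y \<le> ord u \<longrightarrow> reach_within E (V - Z) r u y \<longrightarrow> y = u"
        using ord(3) u by blast
      moreover have "ord u < n" using ord(2) False u by blast
      then have "\<not> ord' v \<le> ord' u" using False unfolding ord'_def by simp
      ultimately show ?thesis using False unfolding ord'_def by (intro exI[of _ Z]) auto
    qed
    ultimately show ?case by blast
  qed
  from this[OF subset_refl refl] show ?thesis by blast
qed

text \<open>
  A walk from \<open>v\<close> down to \<open>y\<close> meets the separator \<open>Z\<close> of \<open>v\<close>, and its remainder witnesses that a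
  vertex of \<open>Z\<close> weakly reaches \<open>y\<close> in fewer steps.
\<close>

lemma card_weak_reach_le:
  assumes "finite V"
    and sep: "\<And>v. v \<in> V \<Longrightarrow> \<exists>Z\<subseteq>V. v \<notin> Z \<and> card Z \<le> k
           \<and> (\<forall>y\<in>V. ord y \<le> ord v \<longrightarrow> reach_within E (V - Z) r v y \<longrightarrow> y = v)"
    and "n \<le> r" "v \<in> V"
  shows "card {y. weak_reach E V ord n v y} \<le> (k + 1) ^ n"
  using assms(3,4)
proof (induction n arbitrary: v)
  case 0
  have "{y. weak_reach E V ord 0 v y} \<subseteq> {v}" unfolding weak_reach_def by auto
  from card_mono[OF _ this] show ?case by simp
next
  case (Suc n)
  obtain Z where Z: "Z \<subseteq> V" "v \<notin> Z" "card Z \<le> k"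
      "\<And>y. y \<in> V \<Longrightarrow> ord y \<le> ord v \<Longrightarrow> reach_within E (V - Z) r v y \<Longrightarrow> y = v"
    using sep[OF Suc.prems(2)] by blast
  have finZ: "finite Z" using Z(1) assms(1) by (rule finite_subset)
  have fin: "finite {y. weak_reach E V ord n z y}" for z
    by (rule finite_subset[OF _ assms(1)]) (auto dest: weak_reach_in)
  have "{y. weak_reach E V ord (Suc n) v y} \<subseteq> insert v (\<Union>z\<in>Z. {y. weak_reach E V ord n z y})"
  proof
    fix y assume "y \<in> {y. weak_reach E V ord (Suc n) v y}"
    then have y: "weak_reach E V ord (Suc n) v y" by simp
    note yV = weak_reach_in[OF y]
    from reach_within_avoid_or_hit[OF y[unfolded weak_reach_def], of Z]
    consider "reach_within E (insert v ({x \<in> V. ord y \<le> ord x} - Z)) (Suc n) v y"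
      | z j where "z \<in> Z" "j < Suc n" "reach_within E {x \<in> V. ord y \<le> ord x} j z y" by blast
    then show "y \<in> insert v (\<Union>z\<in>Z. {y. weak_reach E V ord n z y})"
    proof cases
      case 1
      then have "reach_within E (V - Z) r v y"
        by (rule reach_within_mono) (use Suc.prems Z(2) in auto)
      then show ?thesis using Z(4) yV by simp
    next
      case 2
      then have "weak_reach E V ord j z y" unfolding weak_reach_def by simp
      then have "weak_reach E V ord n z y" by (rule weak_reach_mono) (use 2 in simp)
      then show ?thesis using 2 by blast
    qed
  qed
  then have "card {y. weak_reach E V ord (Suc n) v y}
      \<le> card (insert v (\<Union>z\<in>Z. {y. weak_reach E V ord n z y}))"
    using finZ fin by (intro card_mono) auto
  also have "\<dots> \<le> Suc (card (\<Union>z\<in>Z. {y. weak_reach E V ord n z y}))"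
    by (rule card_insert_le_m1) auto
  also have "card (\<Union>z\<in>Z. {y. weak_reach E V ord n z y}) \<le> (\<Sum>z\<in>Z. card {y. weak_reach E V ord n z y})"
    by (rule card_UN_le[OF finZ])
  also have "\<dots> \<le> (\<Sum>z\<in>Z. (k + 1) ^ n)"
    using Suc.IH Suc.prems Z(1) by (intro sum_mono) auto
  also have "\<dots> \<le> k * (k + 1) ^ n" using Z(3) by simp
  also have "Suc (k * (k + 1) ^ n) \<le> (k + 1) ^ Suc n" by simp
  finally show ?case by simp
qed

text \<open>Colours are given in increasing order of \<open>ord\<close>. As
  \<open>v \<in> P v\<close>, at most \<open>q - 1\<close> colours are forbidden at
  \<open>v\<close>, and \<open>v\<close> belongs to no \<open>P u\<close> of an earlier
  \<open>u\<close>.\<close>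

lemma greedy_coloring:
  fixes ord :: "'a \<Rightarrow> nat" and P :: "'a \<Rightarrow> 'a set"
  assumes "finite V" "inj_on ord V"
    and P: "\<And>v. v \<in> V \<Longrightarrow> P v \<subseteq> V" "\<And>v y. v \<in> V \<Longrightarrow> y \<in> P v \<Longrightarrow> ord y \<le> ord v"
      "\<And>v. v \<in> V \<Longrightarrow> card (P v) \<le> q" "\<And>v. v \<in> V \<Longrightarrow> v \<in> P v"
  shows "\<exists>\<chi> :: 'a \<Rightarrow> nat. \<forall>v\<in>V. \<chi> v < q \<and> (\<forall>y\<in>P v. y \<noteq> v \<longrightarrow> \<chi> y \<noteq> \<chi> v)"
proof -
  have "\<exists>\<chi> :: 'a \<Rightarrow> nat. \<forall>v\<in>V. ord v < n \<longrightarrow> \<chi> v < q \<and> (\<forall>y\<in>P v. y \<noteq> v \<longrightarrow> \<chi> y \<noteq> \<chi> v)" for n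
  proof (induction n)
    case (Suc n)
    then obtain \<chi> :: "'a \<Rightarrow> nat" where
      \<chi>: "\<And>v. v \<in> V \<Longrightarrow> ord v < n \<Longrightarrow> \<chi> v < q \<and> (\<forall>y\<in>P v. y \<noteq> v \<longrightarrow> \<chi> y \<noteq> \<chi> v)" by blast
    show ?case
    proof (cases "\<exists>v\<in>V. ord v = n")
      case False
      then show ?thesis using \<chi> less_Suc_eq by metis
    next
      case True
      then obtain v where v: "v \<in> V" "ord v = n" by blast
      have uniq: "u = v" if "u \<in> V" "ord u = n" for u
        using assms(2) v that by (auto dest: inj_onD)
      have finP: "finite (P v)" using P(1)[OF v(1)] assms(1) by (rule finite_subset)
      have "card (P v - {v}) < card (P v)"
        using P(4)[OF v(1)] finP by (rule card_Diff1_less[rotated])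
      then have "card (\<chi> ` (P v - {v})) < card {..<q}"
        using P(3)[OF v(1)] card_image_le[of "P v - {v}" \<chi>] finP by simp
      then have "\<not> {..<q} \<subseteq> \<chi> ` (P v - {v})" using finP card_mono[of "\<chi> ` (P v - {v})" "{..<q}"] by auto
      then obtain i where i: "i < q" "i \<notin> \<chi> ` (P v - {v})" by blast
      have "(\<chi>(v := i)) u < q \<and> (\<forall>y\<in>P u. y \<noteq> u \<longrightarrow> (\<chi>(v := i)) y \<noteq> (\<chi>(v := i)) u)"
        if u: "u \<in> V" "ord u < Suc n" for u
      proof (cases "u = v")
        case True
        then show ?thesis using i by auto
      next
        case False
        then have "ord u < n" using uniq u less_SucE by blast
        moreover from this have "v \<notin> P u" using P(2)[OF u(1)] v(2) by fastforce
        ultimately show ?thesis using \<chi>[OF u(1)] False by auto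
      qed
      then show ?thesis by blast
    qed
  qed simp
  from this[of "Suc (Max (ord ` V))"] show ?thesis
    using assms(1) by (metis Max_ge finite_imageI image_eqI less_Suc_eq_le)
qed

text \<open>\<open>k\<close> is the size of the separators and \<open>(k + 1) ^ r\<close> the
  resulting size of the weakly reachable sets, which becomes the number of colours.\<close>

lemma weak_reach_coloring:
  fixes G :: "'a pair_pre_digraph" and r c :: nat
  defines "k \<equiv> 2 * c + c * (1 + 2 * r * c * (2 * c + 1))"
  assumes G: "pair_graph G" and nab: "nabla (2 * r) G \<le> real c"
  obtains ord \<chi> :: "'a \<Rightarrow> nat" where "inj_on ord (pverts G)"
    "\<And>v. v \<in> pverts G \<Longrightarrow> \<chi> v < (k + 1) ^ r"
    "\<And>v y. weak_reach (parcs G) (pverts G) ord r v y \<Longrightarrow> \<chi> v = \<chi> y \<Longrightarrow> v = y"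
proof -
  interpret pair_graph G by fact
  note fin = pair_finite_verts
  obtain ord :: "'a \<Rightarrow> nat" where ord: "inj_on ord (pverts G)"
    and sep: "\<And>v. v \<in> pverts G \<Longrightarrow> \<exists>Z\<subseteq>pverts G. v \<notin> Z \<and> card Z \<le> k
           \<and> (\<forall>y\<in>pverts G. ord y \<le> ord v \<longrightarrow> reach_within (parcs G) (pverts G - Z) r v y \<longrightarrow> y = v)"
    using exists_separable_order[OF fin exists_separable_vertex[OF G nab]] unfolding k_def by blast
  let ?P = "\<lambda>v. {y. weak_reach (parcs G) (pverts G) ord r v y}"
  have "\<exists>\<chi> :: 'a \<Rightarrow> nat. \<forall>v\<in>pverts G. \<chi> v < (k + 1) ^ r \<and> (\<forall>y\<in>?P v. y \<noteq> v \<longrightarrow> \<chi> y \<noteq> \<chi> v)"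
    using card_weak_reach_le[OF fin sep order_refl]
    by (intro greedy_coloring[OF fin ord]) (auto dest: weak_reach_in intro: weak_reach_refl)
  then obtain \<chi> :: "'a \<Rightarrow> nat" where
    \<chi>: "\<forall>v\<in>pverts G. \<chi> v < (k + 1) ^ r \<and> (\<forall>y\<in>?P v. y \<noteq> v \<longrightarrow> \<chi> y \<noteq> \<chi> v)" by blast
  show thesis
  proof (rule that[OF ord])
    show "\<chi> v < (k + 1) ^ r" if "v \<in> pverts G" for v using \<chi> that by blast
    show "v = y" if "weak_reach (parcs G) (pverts G) ord r v y" "\<chi> v = \<chi> y" for v y
      using \<chi> that weak_reach_in[OF that(1)] by fastforce
  qed
qed

section \<open>Laminar families and balls\<close>

text \<open>
  An even colour in a maximal set is repaired by recolouring one maximal block below it, which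
  carries that colour an odd number of times.
\<close>

lemma laminar_odd_coloring:
  fixes \<L> :: "'a set set"
  assumes "finite \<L>" "\<And>L. L \<in> \<L> \<Longrightarrow> finite L"
    and "\<And>A B. A \<in> \<L> \<Longrightarrow> B \<in> \<L> \<Longrightarrow> A \<inter> B = {} \<or> A \<subseteq> B \<or> B \<subseteq> A"
    and "\<And>x. card {L \<in> \<L>. x \<in> L} \<le> m"
  shows "\<exists>f :: 'a \<Rightarrow> nat. (\<forall>x. f x < 2 ^ m) \<and>
           (\<forall>L\<in>\<L>. \<forall>i. card {x \<in> L. f x = i} = 0 \<or> odd (card {x \<in> L. f x = i}))"
  using assms
proof (induction m arbitrary: \<L>)
  case 0
  have empty: "L = {}" if "L \<in> \<L>" for L
  proof (rule ccontr)
    assume "L \<noteq> {}"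
    then obtain x where "x \<in> L" by blast
    then have "L \<in> {L \<in> \<L>. x \<in> L}" using that by blast
    then show False using 0(1) 0(4)[of x] by auto
  qed
  have "card {x \<in> L. (0::nat) = i} = 0" if "L \<in> \<L>" for L i
    using empty[OF that] by simp
  then show ?case by (intro exI[of _ "\<lambda>_. 0"] conjI allI ballI disjI1) simp_all
next
  case (Suc m)
  note fin = Suc.prems(1) and finL = Suc.prems(2) and lam = Suc.prems(3) and depth = Suc.prems(4)
  \<comment> \<open>Dropping the maximal sets lowers the depth: a point in a member of
    \<open>\<K>\<close> also lies in a top, which no longer counts.\<close>
  define tops where "tops = {A \<in> \<L>. \<forall>B\<in>\<L>. A \<subseteq> B \<longrightarrow> B = A}"
  define \<K> where "\<K> = \<L> - tops"
  have below_top: "\<exists>A\<in>tops. L \<subseteq> A" if "L \<in> \<L>" for L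
  proof -
    obtain A where "A \<in> \<L>" "L \<subseteq> A" "\<forall>B\<in>\<L>. A \<subseteq> B \<longrightarrow> A = B"
      using finite_has_maximal2[OF fin \<open>L \<in> \<L>\<close>] by auto
    then show ?thesis unfolding tops_def by auto
  qed
  have top_disj: "A = B" if "A \<in> tops" "B \<in> tops" "x \<in> A" "x \<in> B" for A B x
    using that lam[of A B] unfolding tops_def by blast
  have "card {L \<in> \<K>. x \<in> L} \<le> m" for x
  proof (cases "{L \<in> \<K>. x \<in> L} = {}")
    case False
    then obtain L where L: "L \<in> \<K>" "x \<in> L" by auto
    then obtain A where "A \<in> tops" "L \<subseteq> A" using below_top[of L] unfolding \<K>_def by auto
    note LA = L this
    then have "card (insert A {L \<in> \<K>. x \<in> L}) \<le> card {L \<in> \<L>. x \<in> L}"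
      using fin unfolding \<K>_def tops_def by (intro card_mono) auto
    moreover have "A \<notin> {L \<in> \<K>. x \<in> L}" using LA unfolding \<K>_def by blast
    ultimately show ?thesis using depth[of x] fin unfolding \<K>_def by simp
  qed (simp only: card.empty)
  then have "\<exists>f :: 'a \<Rightarrow> nat. (\<forall>x. f x < 2 ^ m) \<and>
      (\<forall>L\<in>\<K>. \<forall>i. card {x \<in> L. f x = i} = 0 \<or> odd (card {x \<in> L. f x = i}))"
    using fin finL lam by (intro Suc.IH) (auto simp: \<K>_def)
  then obtain f :: "'a \<Rightarrow> nat" where fm: "\<And>x. f x < 2 ^ m"
    and fodd: "\<And>L i. L \<in> \<K> \<Longrightarrow> card {x \<in> L. f x = i} = 0 \<or> odd (card {x \<in> L. f x = i})"
    by (elim exE conjE) blast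

  \<comment> \<open>By laminarity the members of \<open>\<K>\<close> around \<open>v\<close> form a
    chain, so the union is the largest of them. A point in no member is a block of its own.\<close>
  define blk where "blk v = insert v (\<Union>{B \<in> \<K>. v \<in> B})" for v
  have blk_sub: "L \<subseteq> blk v \<or> L \<inter> blk v = {}" if "L \<in> \<K>" for L v
    using lam that unfolding blk_def \<K>_def by blast
  have blk_top: "blk v \<subseteq> A" if "A \<in> tops" "v \<in> A" for A v
  proof -
    have "B \<subseteq> A" if B: "B \<in> \<K>" "v \<in> B" for B
    proof -
      have "B \<in> \<L>" "B \<noteq> A" using B \<open>A \<in> tops\<close> unfolding \<K>_def by auto
      then show ?thesis using lam[of A B] \<open>A \<in> tops\<close> \<open>v \<in> A\<close> B(2) unfolding tops_def by auto
    qed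
    then show ?thesis using \<open>v \<in> A\<close> unfolding blk_def by auto
  qed
  have blk_odd: "odd (card {x \<in> blk v. f x = f v})" for v
  proof (cases "\<exists>B\<in>\<K>. v \<in> B")
    case False
    then have "{x \<in> blk v. f x = f v} = {v}" unfolding blk_def by auto
    then show ?thesis by simp
  next
    case True
    have "finite {B \<in> \<K>. v \<in> B}" using fin unfolding \<K>_def by simp
    moreover have "{B \<in> \<K>. v \<in> B} \<noteq> {}" using True by blast
    ultimately obtain M where M: "M \<in> \<K>" "v \<in> M" "\<And>B. B \<in> \<K> \<Longrightarrow> v \<in> B \<Longrightarrow> M \<subseteq> B \<Longrightarrow> B = M"
      using finite_has_maximal[of "{B \<in> \<K>. v \<in> B}"] by auto
    have "B \<subseteq> M" if "B \<in> \<K>" "v \<in> B" for B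
      using lam[of B M] M that unfolding \<K>_def by blast
    then have "blk v = M" using M unfolding blk_def by blast
    moreover have "finite M" using M finL unfolding \<K>_def by blast
    then have "card {x \<in> M. f x = f v} \<noteq> 0" using M(2) by auto
    ultimately show ?thesis using fodd[OF M(1), of "f v"] by simp
  qed

  define bad where "bad A i \<longleftrightarrow> A \<in> tops \<and> {x \<in> A. f x = i} \<noteq> {} \<and> even (card {x \<in> A. f x = i})" for A i
  define p where "p A i = (SOME x. x \<in> A \<and> f x = i)" for A i
  have p: "p A i \<in> A" "f (p A i) = i" if "bad A i" for A i
  proof -
    have "\<exists>x. x \<in> A \<and> f x = i" using that unfolding bad_def by blast
    then have "p A i \<in> A \<and> f (p A i) = i" unfolding p_def by (rule someI_ex)
    then show "p A i \<in> A" "f (p A i) = i" by blast+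
  qed
  \<comment> \<open>Within the chosen block only points of the colour under repair move, and the
    shift by \<open>2 ^ m\<close> lands above all old colours, so they form a fresh colour
    class.\<close>
  define ch where "ch x \<longleftrightarrow> (\<exists>A. bad A (f x) \<and> x \<in> blk (p A (f x)))" for x
  define g where "g x = (if ch x then f x + 2 ^ m else f x)" for x
  have ch_iff: "ch x \<longleftrightarrow> bad A (f x) \<and> x \<in> blk (p A (f x))" if "A \<in> tops" "x \<in> A" for A x
  proof
    assume "ch x"
    then obtain A' where A': "bad A' (f x)" "x \<in> blk (p A' (f x))" unfolding ch_def by blast
    then have "A' \<in> tops" unfolding bad_def by blast
    then have "x \<in> A'" using A' blk_top p by blast
    then have "A' = A" using top_disj that \<open>A' \<in> tops\<close> by blast
    then show "bad A (f x) \<and> x \<in> blk (p A (f x))" using A' by blast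
  qed (auto simp: ch_def)
  have split: "card {x \<in> L. g x = i} = 0 \<or> odd (card {x \<in> L. g x = i})"
    if L: "\<And>j. let X = {x \<in> L. f x = j \<and> \<not> ch x}; Y = {x \<in> L. f x = j \<and> ch x} in
            (X = {} \<or> odd (card X)) \<and> (Y = {} \<or> odd (card Y))" for L i
  proof (cases "i < 2 ^ m")
    case True
    then have "{x \<in> L. g x = i} = {x \<in> L. f x = i \<and> \<not> ch x}" unfolding g_def by auto
    then show ?thesis using L[of i] unfolding Let_def by (metis card.empty)
  next
    case False
    have "f x \<noteq> i" for x using fm[of x] False by auto
    then have "{x \<in> L. g x = i} = {x \<in> L. f x = i - 2 ^ m \<and> ch x}"
      using False unfolding g_def by auto
    then show ?thesis using L[of "i - 2 ^ m"] unfolding Let_def by (metis card.empty)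
  qed
  have "g x < 2 ^ Suc m" for x using fm[of x] unfolding g_def by simp
  moreover have "card {x \<in> L. g x = i} = 0 \<or> odd (card {x \<in> L. g x = i})" if L: "L \<in> \<L>" for L i
  proof (rule split, unfold Let_def)
    fix j
    let ?X = "{x \<in> L. f x = j \<and> \<not> ch x}" and ?Y = "{x \<in> L. f x = j \<and> ch x}"
    let ?Z = "{x \<in> L. f x = j}"
    have finZ: "finite ?Z" using finL[OF L] by simp
    obtain A where A: "A \<in> tops" "L \<subseteq> A" using below_top[OF L] by blast
    have chA: "ch x \<longleftrightarrow> bad A j \<and> x \<in> blk (p A j)" if "x \<in> L" "f x = j" for x
      using ch_iff A that by blast
    show "(?X = {} \<or> odd (card ?X)) \<and> (?Y = {} \<or> odd (card ?Y))"
    proof (cases "L \<in> tops")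
      case True
      then have LA: "L = A" using A unfolding tops_def by blast
      show ?thesis
      proof (cases "bad A j")
        case False
        then have "?Y = {}" "?X = ?Z" using chA by auto
        moreover have "?Z = {} \<or> odd (card ?Z)" using False A(1) LA unfolding bad_def by blast
        ultimately show ?thesis by simp
      next
        case bad: True
        \<comment> \<open>Taking an odd block out of an even class leaves an odd rest.\<close>
        have "?Y = {x \<in> blk (p A j). f x = j}"
          using chA bad LA blk_top[OF A(1) p(1)[OF bad]] by auto
        then have Y: "odd (card ?Y)" using blk_odd[of "p A j"] p(2)[OF bad] by simp
        have "card ?Z = card ?X + card ?Y"
          using finL[OF L] by (subst card_Un_disjoint[symmetric]) (auto intro: arg_cong[where f = card])
        moreover have "even (card ?Z)" using bad LA unfolding bad_def by blast
        ultimately have "odd (card ?X)" using Y by simp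
        then show ?thesis using Y by blast
      qed
    next
      case False
      then have LK: "L \<in> \<K>" using L unfolding \<K>_def by blast
      have Z: "?Z = {} \<or> odd (card ?Z)" using fodd[OF LK, of j] finZ by auto
      \<comment> \<open>A member of \<open>\<K>\<close> lies inside the recoloured block or misses
        it, so its points of colour \<open>j\<close> all move or all stay.\<close>
      show ?thesis
      proof (cases "bad A j \<and> L \<subseteq> blk (p A j)")
        case True
        then have "?X = {}" "?Y = ?Z" using chA by auto
        then show ?thesis using Z by simp
      next
        case False
        then have "?Y = {}" "?X = ?Z" using chA blk_sub[OF LK, of "p A j"] by auto
        then show ?thesis using Z by simp
      qed
    qed
  qed
  ultimately show ?case by blast
qed

section \<open>Signatures, cones and balls\<close>

locale weak_reach_colored =
  fixes E :: "('a \<times> 'a) set" and V :: "'a set" and ord \<chi> :: "'a \<Rightarrow> nat" and d q :: nat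
  assumes symE: "sym E" and finV: "finite V" and inj_ord: "inj_on ord V"
    and EV: "E \<subseteq> V \<times> V" and irreflE: "irrefl E"
    and \<chi>_less: "v \<in> V \<Longrightarrow> \<chi> v < q"
    and rainbow: "weak_reach E V ord (4 * d + 1) v y \<Longrightarrow> \<chi> v = \<chi> y \<Longrightarrow> v = y"
begin

abbreviation "wr \<equiv> weak_reach E V ord"

text \<open>Meaningful only when \<open>v\<close> weakly reaches \<open>w\<close>; otherwise the
  \<open>LEAST\<close> is unspecified.\<close>

definition wdist :: "'a \<Rightarrow> 'a \<Rightarrow> nat" where
  "wdist v w = (LEAST i. wr i v w)"

text \<open>\<open>\<chi>\<close> is injective on the vertices weakly reached from \<open>v\<close>,
  so colours can name them. The pairs encode their order, and the case \<open>w' = w\<close> lets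
  each of them contribute its distance.\<close>

definition signature :: "'a \<Rightarrow> (nat \<times> nat \<times> nat) set" where
  "signature v = {(\<chi> w, \<chi> w', wdist v w) | w w'. wr d v w \<and> wr d v w' \<and> ord w' \<le> ord w}"

definition cone :: "(nat \<times> nat \<times> nat) set \<Rightarrow> 'a \<Rightarrow> 'a set" where
  "cone s w = {v \<in> V. signature v = s \<and> wr d v w}"

lemma wr_wdist: "wr i v w \<Longrightarrow> wr (wdist v w) v w"
  unfolding wdist_def by (rule LeastI)

lemma wdist_le: "wr i v w \<Longrightarrow> wdist v w \<le> i"
  unfolding wdist_def by (rule Least_le)

lemma signature_bound: "v \<in> V \<Longrightarrow> signature v \<in> Pow ({..<q} \<times> {..<q} \<times> {..d})"
  using \<chi>_less wdist_le unfolding signature_def by (auto dest: weak_reach_in)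

text \<open>The higher of the two vertices weakly reaches the lower one, so \<open>rainbow\<close>
  applies to them.\<close>

lemma rainbow_common_source:
  assumes "wr m x y" "wr n x z" "m + n \<le> 4 * d" "\<chi> y = \<chi> z"
  shows "y = z"
proof (cases "ord z \<le> ord y")
  case True
  then have "wr (m + n) y z" using weak_reach_common_source[OF symE assms(1,2)] by simp
  then have "wr (4 * d + 1) y z" by (rule weak_reach_mono) (use assms(3) in simp)
  then show ?thesis using rainbow assms(4) by blast
next
  case False
  then have "wr (n + m) z y" using weak_reach_common_source[OF symE assms(2,1)] by simp
  then have "wr (4 * d + 1) z y" by (rule weak_reach_mono) (use assms(3) in simp)
  then show ?thesis using rainbow assms(4) by metis
qed

lemma signature_transfer:
  assumes "signature v = signature v'" "wr d v' w"
  obtains y where "wr d v y" "\<chi> y = \<chi> w" "wdist v y = wdist v' w"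
proof -
  have "(\<chi> w, \<chi> w, wdist v' w) \<in> signature v" using assms unfolding signature_def by auto
  then show thesis unfolding signature_def by (auto intro: that)
qed

text \<open>Here the order entries do their work. \<open>v\<close> reaches some \<open>y\<close>
  coloured like \<open>w'\<close>. If \<open>y\<close> is not above \<open>w\<close>, then
  \<open>w\<close> reaches both \<open>y\<close> and \<open>w'\<close>, which therefore coincide.
  Otherwise equal signatures give \<open>v'\<close> a vertex \<open>b\<close> coloured like
  \<open>w\<close> and not above \<open>w'\<close>; the chain \<open>w\<close>, \<open>w'\<close>,
  \<open>b\<close> forces \<open>b = w\<close>, and then \<open>w = w'\<close>.\<close>

lemma signature_wr:
  assumes sig: "signature v = signature v'" and v: "wr d v w" "wr d v' w'" and w: "wr (2 * d) w w'"
  shows "wr d v w'"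
proof -
  obtain y where y: "wr d v y" "\<chi> y = \<chi> w'" using signature_transfer[OF sig v(2)] by blast
  show ?thesis
  proof (cases "ord y \<le> ord w")
    case True
    then have "wr (d + d) w y" using weak_reach_common_source[OF symE v(1) y(1)] by simp
    then have "y = w'" using rainbow_common_source[OF _ w] y(2) by simp
    then show ?thesis using y(1) by simp
  next
    case False
    then have "ord w \<le> ord y" by simp
    then have "(\<chi> y, \<chi> w, wdist v y) \<in> signature v" using y(1) v(1) unfolding signature_def by blast
    then have "(\<chi> y, \<chi> w, wdist v y) \<in> signature v'" using sig by simp
    then obtain a b where ab: "wr d v' a" "wr d v' b" "\<chi> a = \<chi> y" "\<chi> b = \<chi> w" "ord b \<le> ord a"
      unfolding signature_def by auto
    have "a = w'" using rainbow_common_source[OF ab(1) v(2)] ab(3) y(2) by simp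
    then have "wr (d + d) w' b" using weak_reach_common_source[OF symE ab(1,2,5)] by simp
    \<comment> \<open>Two stretches of length \<open>2 * d\<close> use up the radius
      \<open>4 * d\<close>.\<close>
    then have "wr (2 * d + (d + d)) w b" by (rule weak_reach_trans[OF w])
    then have "wr (4 * d + 1) w b" by (rule weak_reach_mono) simp
    then have "w = b" using rainbow ab(4) by metis
    then have "ord w = ord w'" using ab(5) \<open>a = w'\<close> weak_reach_in[OF w] by simp
    then have "w = w'" using inj_ord weak_reach_in[OF w] by (auto dest: inj_onD)
    then show ?thesis using v(1) by simp
  qed
qed

lemma cone_mono:
  assumes "wr (2 * d) w w'" "cone s w' \<noteq> {}"
  shows "cone s w \<subseteq> cone s w'"
proof
  fix v assume v: "v \<in> cone s w"
  obtain v' where "v' \<in> cone s w'" using assms(2) by blast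
  then show "v \<in> cone s w'" using v signature_wr[of v v' w w'] assms(1) unfolding cone_def by auto
qed

lemma cone_mono_common_source:
  assumes "wr d u w" "wr d u w'" "ord w' \<le> ord w" "cone s w' \<noteq> {}"
  shows "cone s w \<subseteq> cone s w'"
  using cone_mono[OF _ assms(4)] weak_reach_common_source[OF symE assms(1-3)] by (simp add: mult_2)

text \<open>For a common member of both cones, the lower apex is weakly reached from the higher one,
  and its cone is the larger.\<close>

lemma cone_laminar: "cone s w \<inter> cone s w' = {} \<or> cone s w \<subseteq> cone s w' \<or> cone s w' \<subseteq> cone s w"
proof (cases "cone s w \<inter> cone s w' = {}")
  case False
  then obtain v where v: "v \<in> cone s w" "v \<in> cone s w'" by blast
  then have wr: "wr d v w" "wr d v w'" and ne: "cone s w \<noteq> {}" "cone s w' \<noteq> {}"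
    unfolding cone_def by auto
  show ?thesis
    using cone_mono_common_source[OF wr _ ne(2)] cone_mono_common_source[OF wr(2,1) _ ne(1)]
    by (cases "ord w' \<le> ord w") auto
qed simp

text \<open>The apexes of the cones around \<open>x\<close> are weakly reached from
  \<open>x\<close>, hence have distinct colours.\<close>

lemma card_cones_le: "card {L \<in> cone s ` V. x \<in> L} \<le> q"
proof -
  have fin: "finite {w. wr d x w}"
    by (rule finite_subset[OF _ finV]) (auto dest: weak_reach_in)
  have "card {L \<in> cone s ` V. x \<in> L} \<le> card (cone s ` {w. wr d x w})"
    using fin by (intro card_mono) (auto simp: cone_def)
  also have "\<dots> \<le> card {w. wr d x w}" by (rule card_image_le[OF fin])
  also have "\<dots> \<le> card {..<q}"
  proof (rule card_inj_on_le)
    show "inj_on \<chi> {w. wr d x w}"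
      by (rule inj_onI) (auto intro: rainbow_common_source[of d x _ d])
    show "\<chi> ` {w. wr d x w} \<subseteq> {..<q}" using \<chi>_less by (auto dest: weak_reach_in)
  qed simp
  finally show ?thesis by simp
qed

text \<open>Cutting short walks from \<open>u\<close> at their lowest vertices covers
  \<open>B u s\<close> by cones. All their apexes are weakly reached from \<open>u\<close>, so the
  cone of the lowest apex swallows the rest.\<close>

lemma ball_eq_cone:
  defines "B \<equiv> \<lambda>u s. {v \<in> V. signature v = s \<and> reach_within E V d u v}"
  shows "B u s = {} \<or> B u s \<in> cone s ` V"
proof (cases "B u s = {}")
  case False
  \<comment> \<open>One witness \<open>v\<close> vouches for the whole cone of \<open>w\<close>,
    since equal signatures give equal \<open>wdist\<close> to \<open>w\<close>.\<close>
  define I where "I = {w. wr d u w \<and> (\<exists>v\<in>V. signature v = s \<and> wr d v w \<and> wdist u w + wdist v w \<le> d)}"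
  have cone_sub: "cone s w \<subseteq> B u s" if "w \<in> I" for w
  proof
    fix v assume v: "v \<in> cone s w"
    obtain v' where v': "wr d u w" "signature v' = s" "wr d v' w" "wdist u w + wdist v' w \<le> d"
      using \<open>w \<in> I\<close> unfolding I_def by blast
    have sv: "v \<in> V" "signature v = s" "wr d v w" using v unfolding cone_def by auto
    have "signature v = signature v'" using sv(2) v'(2) by simp
    then obtain y where y: "wr d v y" "\<chi> y = \<chi> w" "wdist v y = wdist v' w"
      using signature_transfer v'(3) by blast
    have "y = w" using rainbow_common_source[OF y(1) sv(3)] y(2) by simp
    then have "wdist u w + wdist v w \<le> d" using y(3) v'(4) by simp
    then have "reach_within E V d u v"
      using reach_within_iff_weak_reach[OF symE, of V d u v ord] wr_wdist[OF v'(1)] wr_wdist[OF sv(3)]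
      by blast
    then show "v \<in> B u s" using sv unfolding B_def by simp
  qed
  have cover: "\<exists>w\<in>I. v \<in> cone s w" if "v \<in> B u s" for v
  proof -
    have v: "v \<in> V" "signature v = s" "reach_within E V d u v" using that unfolding B_def by auto
    then obtain w i j where w: "i + j \<le> d" "wr i u w" "wr j v w"
      using reach_within_iff_weak_reach[OF symE, of V d u v ord] by blast
    have "wr d u w" "wr d v w" using w weak_reach_mono[OF w(2)] weak_reach_mono[OF w(3)] by auto
    moreover have "wdist u w + wdist v w \<le> d" using wdist_le[OF w(2)] wdist_le[OF w(3)] w(1) by simp
    ultimately show ?thesis using v unfolding I_def cone_def by blast
  qed
  have "I \<noteq> {}" using False cover by blast
  then obtain w where w: "w \<in> I" "\<And>w'. w' \<in> I \<Longrightarrow> ord w \<le> ord w'"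
    using ex_has_least_nat[of "\<lambda>w. w \<in> I" _ ord] by blast
  have "cone s w \<noteq> {}" and wrw: "wr d u w" using w(1) unfolding I_def cone_def by blast+
  then have "cone s w' \<subseteq> cone s w" if "w' \<in> I" for w'
    using cone_mono_common_source[OF _ wrw w(2)[OF that]] that unfolding I_def by blast
  then have "B u s = cone s w" using cover cone_sub[OF w(1)] by blast
  then show ?thesis using weak_reach_in[OF wrw] by blast
qed simp

lemma odd_coloring:
  "\<exists>f :: 'a \<Rightarrow> nat. (\<forall>v\<in>V. f v < card (Pow ({..<q} \<times> {..<q} \<times> {..d})) * 2 ^ q)
     \<and> (\<forall>(u, v)\<in>E. f u \<noteq> f v)
     \<and> (\<forall>u i. card {v \<in> V. f v = i \<and> reach_within E V d u v} = 0
            \<or> odd (card {v \<in> V. f v = i \<and> reach_within E V d u v}))"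
proof -
  let ?Sig = "Pow ({..<q} \<times> {..<q} \<times> {..d})"
  obtain h where h: "bij_betw h ?Sig {0..<card ?Sig}"
    using ex_bij_betw_finite_nat[of ?Sig] by auto
  have "\<exists>f :: 'a \<Rightarrow> nat. (\<forall>x. f x < 2 ^ q) \<and>
      (\<forall>L\<in>cone s ` V. \<forall>i. card {x \<in> L. f x = i} = 0 \<or> odd (card {x \<in> L. f x = i}))" for s
  proof (rule laminar_odd_coloring)
    show "finite L" if "L \<in> cone s ` V" for L using that finV by (auto simp: cone_def)
    show "A \<inter> B = {} \<or> A \<subseteq> B \<or> B \<subseteq> A" if "A \<in> cone s ` V" "B \<in> cone s ` V" for A B
      using that cone_laminar by blast
  qed (use finV card_cones_le in auto)
  then obtain F :: "(nat \<times> nat \<times> nat) set \<Rightarrow> 'a \<Rightarrow> nat" where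
    F: "\<forall>s. (\<forall>x. F s x < 2 ^ q) \<and>
      (\<forall>L\<in>cone s ` V. \<forall>i. card {x \<in> L. F s x = i} = 0 \<or> odd (card {x \<in> L. F s x = i}))"
    using choice[where Q = "\<lambda>s f. (\<forall>x. f x < 2 ^ q) \<and>
      (\<forall>L\<in>cone s ` V. \<forall>i. card {x \<in> L. f x = i} = 0 \<or> odd (card {x \<in> L. f x = i}))"] by blast
  \<comment> \<open>Quotient and remainder by \<open>2 ^ q\<close> recover the signature and the
    colour inside its class.\<close>
  define f where "f v = h (signature v) * 2 ^ q + F (signature v) v" for v
  have sig_eq: "signature u = signature v \<and> F (signature u) u = F (signature u) v"
    if "u \<in> V" "v \<in> V" "f u = f v" for u v
  proof -
    have "f x div 2 ^ q = h (signature x)" "f x mod 2 ^ q = F (signature x) x" for x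
      using F unfolding f_def by auto
    then have "h (signature u) = h (signature v)" "F (signature u) u = F (signature v) v"
      using that(3) by metis+
    then show ?thesis
      using h signature_bound that by (metis bij_betw_imp_inj_on inj_onD)
  qed
  have "f v < card ?Sig * 2 ^ q" if "v \<in> V" for v
  proof -
    have "h (signature v) < card ?Sig"
      using bij_betwE[OF h] signature_bound[OF that] by (meson atLeastLessThan_iff)
    then have "(h (signature v) + 1) * 2 ^ q \<le> card ?Sig * 2 ^ q" by (intro mult_le_mono1) simp
    moreover have "F (signature v) v < 2 ^ q" using F by blast
    ultimately show ?thesis unfolding f_def by (simp add: algebra_simps)
  qed
  moreover have "f u \<noteq> f v" if uv: "(u, v) \<in> E" for u v
  proof
    assume "f u = f v"
    have V: "u \<in> V" "v \<in> V" using uv EV by auto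
    then have sig: "signature u = signature v" using sig_eq \<open>f u = f v\<close> by blast
    \<comment> \<open>Only \<open>u\<close> itself is at weak distance \<open>0\<close> from
      \<open>u\<close>, so equal signatures force \<open>\<chi> u = \<chi> v\<close>, which an edge
      forbids.\<close>
    obtain y where y: "wr d u y" "\<chi> y = \<chi> v" "wdist u y = wdist v v"
      using signature_transfer[OF sig] weak_reach_refl[OF V(2)] by blast
    have "wdist v v = 0" using wdist_le[of 0 v v] weak_reach_refl[OF V(2)] by simp
    then have "wr 0 u y" using wr_wdist[OF y(1)] y(3) by simp
    then have "\<chi> u = \<chi> v" using y(2) by (simp add: weak_reach_def)
    have "wr 1 u v \<or> wr 1 v u"
      using uv V symE unfolding weak_reach_def by (auto dest: symD)
    then have "wr (4 * d + 1) u v \<or> wr (4 * d + 1) v u" using weak_reach_mono by fastforce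
    then have "u = v" using rainbow \<open>\<chi> u = \<chi> v\<close> by metis
    then show False using uv irreflE unfolding irrefl_def by blast
  qed
  moreover have "card {v \<in> V. f v = i \<and> reach_within E V d u v} = 0
      \<or> odd (card {v \<in> V. f v = i \<and> reach_within E V d u v})" (is "card ?X = 0 \<or> _") for u i
  proof (cases "?X = {}")
    case True
    then show ?thesis by (metis card.empty)
  next
    case False
    then obtain v where v: "v \<in> V" "f v = i" "reach_within E V d u v" by blast
    define s where "s = signature v"
    define B where "B = {x \<in> V. signature x = s \<and> reach_within E V d u x}"
    have "f x = i \<longleftrightarrow> signature x = s \<and> F s x = F s v" if "x \<in> V" for x
      using sig_eq[OF that v(1)] v(2) unfolding s_def f_def by auto
    then have X: "?X = {x \<in> B. F s x = F s v}" unfolding B_def by auto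
    have "v \<in> B" using v unfolding B_def s_def by simp
    then have "B \<in> cone s ` V" using ball_eq_cone[where u = u and s = s] unfolding B_def by auto
    from F[THEN spec, THEN conjunct2, THEN bspec, OF this] show ?thesis unfolding X by (rule spec)
  qed
  ultimately show ?thesis by (intro exI[of _ f]) auto
qed

end

section \<open>Choice of the constants and conclusion\<close>

theorem theorem1p2:
  fixes d :: nat and \<C> :: "'a pair_pre_digraph set"
  assumes "\<forall>G\<in>\<C>. pair_graph G"
    and "bounded_expansion \<C>"
  shows "\<exists>c::nat. \<forall>G\<in>\<C>. \<exists>f :: 'a \<Rightarrow> nat. proper_coloring G {..<c} f \<and>
           (\<forall>u\<in>pverts G. \<forall>i<c.
              card {v \<in> pverts G. f v = i \<and> gdist G u v \<le> ereal (real d)} = 0 \<or>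
              odd (card {v \<in> pverts G. f v = i \<and> gdist G u v \<le> ereal (real d)}))"
proof -
  define r where "r = 4 * d + 1"
  obtain b :: real where b: "\<And>G. G \<in> \<C> \<Longrightarrow> nabla (2 * r) G \<le> b"
    using assms(2) unfolding bounded_expansion_def by blast
  \<comment> \<open>The counting takes place in \<open>nat\<close>; rounding up, with
    \<open>0\<close> for negative \<open>b\<close>, preserves the bound.\<close>
  define c where "c = nat \<lceil>b\<rceil>"
  have nab: "nabla (2 * r) G \<le> real c" if "G \<in> \<C>" for G
    using b[OF that] real_nat_ceiling_ge[of b] unfolding c_def by linarith
  define q where "q = (2 * c + c * (1 + 2 * r * c * (2 * c + 1)) + 1) ^ r"
  define K where "K = card (Pow ({..<q} \<times> {..<q} \<times> {..d})) * 2 ^ q"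
  show ?thesis
  proof (intro exI[of _ K] ballI)
    fix G assume GC: "G \<in> \<C>"
    then have G: "pair_graph G" using assms(1) by blast
    then interpret G: pair_graph G .
    obtain ord \<chi> :: "'a \<Rightarrow> nat" where ord: "inj_on ord (pverts G)"
      and \<chi>: "\<And>v. v \<in> pverts G \<Longrightarrow> \<chi> v < q"
        "\<And>v y. weak_reach (parcs G) (pverts G) ord r v y \<Longrightarrow> \<chi> v = \<chi> y \<Longrightarrow> v = y"
      using weak_reach_coloring[OF G nab[OF GC]] unfolding q_def by blast
    interpret weak_reach_colored "parcs G" "pverts G" ord \<chi> d q
    proof
      show "sym (parcs G)" by (auto intro!: symI dest: G.arcs_symmetric)
      show "parcs G \<subseteq> pverts G \<times> pverts G" by (auto intro: G.in_arcsD1 G.in_arcsD2)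
      show "irrefl (parcs G)" unfolding irrefl_def using G.no_loops' by blast
    qed (use ord \<chi> G.pair_finite_verts in \<open>auto simp: r_def\<close>)
    obtain f :: "'a \<Rightarrow> nat" where f: "\<forall>v\<in>pverts G. f v < K" "\<forall>(u, v)\<in>parcs G. f u \<noteq> f v"
      "\<forall>u i. card {v \<in> pverts G. f v = i \<and> reach_within (parcs G) (pverts G) d u v} = 0
            \<or> odd (card {v \<in> pverts G. f v = i \<and> reach_within (parcs G) (pverts G) d u v})"
      using odd_coloring unfolding K_def by blast
    have "proper_coloring G {..<K} f" using f(1,2) unfolding proper_coloring_def by auto
    then show "\<exists>f :: 'a \<Rightarrow> nat. proper_coloring G {..<K} f \<and>
           (\<forall>u\<in>pverts G. \<forall>i<K.
              card {v \<in> pverts G. f v = i \<and> gdist G u v \<le> ereal (real d)} = 0 \<or>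
              odd (card {v \<in> pverts G. f v = i \<and> gdist G u v \<le> ereal (real d)}))"
      using f(3) unfolding gdist_le_iff_reach_within[OF G.pair_wf_digraph] by blast
  qed
qed

end
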